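(* For any orientation $\vec G$ of the Coxeter diagram of $B_n$, the Cambrian lattice $\mathcal C(\vec G)$ is a sublattice of the weak order on $B_n$: the set of elements that are minimal in their $\Theta(\vec G)$-class (which, as an induced subposet, is isomorphic to $\mathcal C(\vec G)$) is closed under the meet and join of the weak order on $B_n$.
   Context: $B_n$: signed permutations of $\pm[n]$ with Coxeter generators $s_0=(-1\ 1)$, $s_i=(i\ i{+}1)(-i{-}1\ {-i})$, $i\in[n-1]$; diagram $s_0\overset{4}{-}s_1-\cdots-s_{n-1}$. Weak order $v\le w$ iff $I(v)\subseteq I(w)$, $I(w)$ the set of reflections $t$ with $\ell(tw)<\ell(w)$; it is a lattice. $\Theta(\vec G)$: smallest lattice congruence of the weak order with $t$ congruent to the element with alternating word $tsts\cdots$ of $m(s,t)-1$ letters for each directed edge $s\to t$; congruence classes are intervals; $\mathcal C(\vec G)$ is the quotient lattice. *)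

theory Defs
  imports Main
begin

text \<open>A signed permutation is a bijection w of the integers with w(-i) = -w(i),
  fixing 0 and every i with |i| > n; i.e. a signed permutation of +-[n].\<close>
definition Bn :: "nat \<Rightarrow> (int \<Rightarrow> int) set" where
  "Bn n = {w. bij w \<and> (\<forall>i. w (- i) = - w i) \<and> (\<forall>i. (i = 0 \<or> \<bar>i\<bar> > int n) \<longrightarrow> w i = i)}"

definition gen :: "nat \<Rightarrow> int \<Rightarrow> int" where
  "gen i = (if i = 0 then (\<lambda>x. if x = 1 then -1 else if x = -1 then 1 else x)
            else (\<lambda>x. if x = int i then int i + 1 else if x = int i + 1 then int i
                       else if x = - int i then - int i - 1 else if x = - int i - 1 then - int i
                       else x))"

definition word_prod :: "nat list \<Rightarrow> int \<Rightarrow> int" where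
  "word_prod ws = foldr (\<lambda>i acc. gen i \<circ> acc) ws id"

definition is_word :: "nat \<Rightarrow> nat list \<Rightarrow> bool" where
  "is_word n ws \<longleftrightarrow> set ws \<subseteq> {..<n}"

definition len :: "nat \<Rightarrow> (int \<Rightarrow> int) \<Rightarrow> nat" where
  "len n w = (LEAST k. \<exists>ws. is_word n ws \<and> length ws = k \<and> word_prod ws = w)"

definition reflections :: "nat \<Rightarrow> (int \<Rightarrow> int) set" where
  "reflections n = {u \<circ> gen i \<circ> inv u | u i. u \<in> Bn n \<and> i < n}"

definition inv_set :: "nat \<Rightarrow> (int \<Rightarrow> int) \<Rightarrow> (int \<Rightarrow> int) set" where
  "inv_set n w = {t \<in> reflections n. len n (t \<circ> w) < len n w}"

definition wle :: "nat \<Rightarrow> (int \<Rightarrow> int) \<Rightarrow> (int \<Rightarrow> int) \<Rightarrow> bool" where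
  "wle n v w \<longleftrightarrow> inv_set n v \<subseteq> inv_set n w"

definition is_meet :: "nat \<Rightarrow> (int \<Rightarrow> int) \<Rightarrow> (int \<Rightarrow> int) \<Rightarrow> (int \<Rightarrow> int) \<Rightarrow> bool" where
  "is_meet n x y m \<longleftrightarrow> m \<in> Bn n \<and> wle n m x \<and> wle n m y \<and>
     (\<forall>u \<in> Bn n. wle n u x \<and> wle n u y \<longrightarrow> wle n u m)"

definition is_join :: "nat \<Rightarrow> (int \<Rightarrow> int) \<Rightarrow> (int \<Rightarrow> int) \<Rightarrow> (int \<Rightarrow> int) \<Rightarrow> bool" where
  "is_join n x y j \<longleftrightarrow> j \<in> Bn n \<and> wle n x j \<and> wle n y j \<and>
     (\<forall>u \<in> Bn n. wle n x u \<and> wle n y u \<longrightarrow> wle n j u)"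

definition lattice_cong :: "nat \<Rightarrow> ((int \<Rightarrow> int) \<times> (int \<Rightarrow> int)) set \<Rightarrow> bool" where
  "lattice_cong n C \<longleftrightarrow> equiv (Bn n) C \<and>
     (\<forall>x y z m1 m2. (x, y) \<in> C \<longrightarrow> z \<in> Bn n \<longrightarrow> is_meet n x z m1 \<longrightarrow> is_meet n y z m2
        \<longrightarrow> (m1, m2) \<in> C) \<and>
     (\<forall>x y z j1 j2. (x, y) \<in> C \<longrightarrow> z \<in> Bn n \<longrightarrow> is_join n x z j1 \<longrightarrow> is_join n y z j2
        \<longrightarrow> (j1, j2) \<in> C)"

text \<open>Directed edges are pairs (a,b) of generator indices meaning s_a \<rightarrow> s_b.\<close>
definition is_orientation :: "nat \<Rightarrow> (nat \<times> nat) set \<Rightarrow> bool" where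
  "is_orientation n D \<longleftrightarrow>
     D \<subseteq> {(a, b). a < n \<and> b < n \<and> (b = a + 1 \<or> a = b + 1)} \<and>
     (\<forall>i. i + 1 < n \<longrightarrow> ((i, i + 1) \<in> D \<longleftrightarrow> (i + 1, i) \<notin> D))"

definition mcox :: "nat \<Rightarrow> nat \<Rightarrow> nat" where
  "mcox a b = (if {a, b} = {0, 1} then 4 else 3)"

definition alt_word :: "nat \<Rightarrow> nat \<Rightarrow> nat \<Rightarrow> nat list" where
  "alt_word t s k = map (\<lambda>j. if even j then t else s) [0..<k]"

definition cgens :: "(nat \<times> nat) set \<Rightarrow> ((int \<Rightarrow> int) \<times> (int \<Rightarrow> int)) set" where
  "cgens D = {(gen b, word_prod (alt_word b a (mcox a b - 1))) | a b. (a, b) \<in> D}"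

definition Theta :: "nat \<Rightarrow> (nat \<times> nat) set \<Rightarrow> ((int \<Rightarrow> int) \<times> (int \<Rightarrow> int)) set" where
  "Theta n D = \<Inter> {C. lattice_cong n C \<and> cgens D \<subseteq> C}"

definition cambrian_mins :: "nat \<Rightarrow> (nat \<times> nat) set \<Rightarrow> (int \<Rightarrow> int) set" where
  "cambrian_mins n D = {x \<in> Bn n. \<not> (\<exists>y \<in> Bn n. (x, y) \<in> Theta n D \<and> wle n y x \<and> y \<noteq> x)}"

end

theory Submission
  imports Defs
begin

text \<open>
  Identify a signed permutation with its set of inverted pairs of values \<open>a < c\<close> in \<open>\<plusminus>[n]\<close>. These are
  exactly the symmetric biclosed sets, and the weak order is inclusion. Reading the orientation as
  a colouring of the values by low and high, antisymmetric under negation, call an inversion set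
  aligned if each inverted pair \<open>(a, c)\<close> and each \<open>b\<close> strictly between force \<open>(a, b)\<close> to be inverted
  when \<open>b\<close> is low and \<open>(b, c)\<close> when \<open>b\<close> is high. Such single-premise conditions pass to
  intersections, and alignment already implies the condition on complements, so the intersection
  of two aligned inversion sets is an inversion set, hence the meet. Joins are transitive closures
  of unions, and a chain from \<open>a\<close> to \<open>c\<close> has to pass or to cross \<open>b\<close>, so alignment survives too.

  It remains to see that the minimal elements of the classes are the aligned ones. The largest
  aligned set below an inversion set and the smallest dually aligned set above it determine each
  other, so having the same aligned part is a lattice congruence; it contains the generating pairs,
  so aligned elements are minimal. Conversely, a violation between a pair \<open>(a, c)\<close> in adjacent
  positions contracts the corresponding cover relation: by induction on \<open>c - a\<close>, a contracted
  cover with a smaller label is joined with a suitable element and met with the given one.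
\<close>

section \<open>Inversion sets of signed permutations\<close>


text \<open>The colouring must be antisymmetric because \<open>(a, c)\<close> and
  \<open>(- c, - a)\<close> are two names of one reflection, so the rules at \<open>b\<close> and at
  \<open>- b\<close> have to be mirror images. The colours come from the generating pairs: the upper
  member attached to a low \<open>b\<close> inverts the two neighbours of \<open>b\<close> with each
  other but not the lower neighbour with \<open>b\<close>, which is the smallest violation of
  alignment.

  \<open>Theta\<close> is never computed. It is squeezed: being contained in the congruence of equal
  aligned parts makes aligned elements minimal, while every other element is joined by one
  contracted cover to a smaller one.

  The obstacle in type B is that moving \<open>a\<close>, \<open>e\<close>, \<open>c\<close> into
  consecutive positions moves their negatives as well. A third value \<open>e\<close> is usable only
  if this causes no collision. Besides the generating labels, some labels near 0 admit no such
  \<open>e\<close> and need explicit permutations, and a symmetric label \<open>(- c, c)\<close>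
  needs an octagon instead of a hexagon.\<close>

definition vals :: "nat \<Rightarrow> int set" where
  "vals n = {a. a \<noteq> 0 \<and> \<bar>a\<bar> \<le> int n}"

definition roots :: "nat \<Rightarrow> (int \<times> int) set" where
  "roots n = {(a, c). a \<in> vals n \<and> c \<in> vals n \<and> a < c}"

definition kinv :: "nat \<Rightarrow> (int \<Rightarrow> int) \<Rightarrow> (int \<times> int) set" where
  "kinv n p = {(a, c) \<in> roots n. p c < p a}"

text \<open>\<open>kinv\<close> sees only the relative order of the keys, so any distinct integers
  that change sign with the value will do. Later constructions can thus prescribe an arrangement by
  levels without normalising it to a signed permutation.\<close>

definition odd_key :: "nat \<Rightarrow> (int \<Rightarrow> int) \<Rightarrow> bool" where
  "odd_key n p \<longleftrightarrow> inj_on p (vals n) \<and> (\<forall>a \<in> vals n. p (- a) = - p a)"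

abbreviation invs :: "nat \<Rightarrow> (int \<Rightarrow> int) \<Rightarrow> (int \<times> int) set" where
  "invs n w \<equiv> kinv n (inv w)"

definition biclosed :: "nat \<Rightarrow> (int \<times> int) set \<Rightarrow> bool" where
  "biclosed n X \<longleftrightarrow> X \<subseteq> roots n \<and> (\<forall>a c. (a, c) \<in> X \<longrightarrow> (- c, - a) \<in> X) \<and>
     (\<forall>a b c. (a, b) \<in> X \<longrightarrow> (b, c) \<in> X \<longrightarrow> (a, c) \<in> X) \<and>
     (\<forall>a b c. (a, c) \<in> X \<longrightarrow> b \<in> vals n \<longrightarrow> a < b \<longrightarrow> b < c \<longrightarrow> (a, b) \<in> X \<or> (b, c) \<in> X)"

text \<open>The reflection attached to the pair \<open>(a, c)\<close>. For \<open>c = - a\<close>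
  the first two branches take precedence and give a sign change.\<close>

definition tr :: "int \<Rightarrow> int \<Rightarrow> int \<Rightarrow> int" where
  "tr a c = (\<lambda>x. if x = a then c else if x = c then a else if x = - a then - c
                 else if x = - c then - a else x)"

lemma vals_uminus [simp]: "- a \<in> vals n \<longleftrightarrow> a \<in> vals n"
  by (auto simp: vals_def)

lemma finite_vals [simp]: "finite (vals n)"
  by (rule finite_subset [of _ "{- int n..int n}"]) (auto simp: vals_def)

lemma vals_nz: "a \<in> vals n \<Longrightarrow> a \<noteq> 0"
  by (auto simp: vals_def)

lemma finite_roots [simp]: "finite (roots n)"
  by (rule finite_subset [of _ "vals n \<times> vals n"]) (auto simp: roots_def)

lemma roots_uminus: "(- c, - a) \<in> roots n \<longleftrightarrow> (a, c) \<in> roots n"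
  by (auto simp: roots_def)

lemma kinv_subset: "kinv n p \<subseteq> roots n"
  by (auto simp: kinv_def)

lemma finite_kinv [simp]: "finite (kinv n p)"
  using finite_subset [OF kinv_subset finite_roots] .

lemma kinv_iff: "(a, c) \<in> kinv n p \<longleftrightarrow> a \<in> vals n \<and> c \<in> vals n \<and> a < c \<and> p c < p a"
  by (auto simp: kinv_def roots_def)

lemma odd_key_eq_iff: "odd_key n p \<Longrightarrow> a \<in> vals n \<Longrightarrow> b \<in> vals n \<Longrightarrow> p a = p b \<longleftrightarrow> a = b"
  by (auto simp: odd_key_def inj_on_def)

lemma odd_key_uminus: "odd_key n p \<Longrightarrow> a \<in> vals n \<Longrightarrow> p (- a) = - p a"
  by (auto simp: odd_key_def)

lemma biclosedI:
  assumes "X \<subseteq> roots n" "\<And>a c. (a, c) \<in> X \<Longrightarrow> (- c, - a) \<in> X"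
    "\<And>a b c. (a, b) \<in> X \<Longrightarrow> (b, c) \<in> X \<Longrightarrow> (a, c) \<in> X"
    "\<And>a b c. (a, c) \<in> X \<Longrightarrow> b \<in> vals n \<Longrightarrow> a < b \<Longrightarrow> b < c \<Longrightarrow> (a, b) \<in> X \<or> (b, c) \<in> X"
  shows "biclosed n X"
  using assms unfolding biclosed_def by blast

lemma kinv_biclosed:
  assumes "odd_key n p"
  shows "biclosed n (kinv n p)"
proof -
  have "(a, b) \<in> kinv n p \<or> (b, c) \<in> kinv n p"
    if "(a, c) \<in> kinv n p" "b \<in> vals n" "a < b" "b < c" for a b c
    using that unfolding kinv_iff by linarith
  then show ?thesis
    unfolding biclosed_def using kinv_subset odd_key_uminus [OF assms] by (auto simp: kinv_iff)
qed

lemma biclosed_subset: "biclosed n X \<Longrightarrow> X \<subseteq> roots n"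
  by (simp add: biclosed_def)

lemma biclosed_roots: "biclosed n X \<Longrightarrow> (a, c) \<in> X \<Longrightarrow> a \<in> vals n \<and> c \<in> vals n \<and> a < c"
  by (auto simp: biclosed_def roots_def)

lemma biclosed_sym: "biclosed n X \<Longrightarrow> (- c, - a) \<in> X \<longleftrightarrow> (a, c) \<in> X"
  unfolding biclosed_def by (metis minus_minus)

lemma biclosed_trans: "biclosed n X \<Longrightarrow> (a, b) \<in> X \<Longrightarrow> (b, c) \<in> X \<Longrightarrow> (a, c) \<in> X"
  unfolding biclosed_def by blast

lemma biclosed_split:
  "biclosed n X \<Longrightarrow> (a, c) \<in> X \<Longrightarrow> b \<in> vals n \<Longrightarrow> a < b \<Longrightarrow> b < c \<Longrightarrow> (a, b) \<in> X \<or> (b, c) \<in> X"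
  unfolding biclosed_def by blast

section \<open>The group of signed permutations and its reflections\<close>

lemma Bn_bij: "w \<in> Bn n \<Longrightarrow> bij w"
  by (simp add: Bn_def)

lemma Bn_uminus: "w \<in> Bn n \<Longrightarrow> w (- i) = - w i"
  by (simp add: Bn_def)

lemma Bn_out: "w \<in> Bn n \<Longrightarrow> i \<notin> vals n \<Longrightarrow> w i = i"
  by (auto simp: Bn_def vals_def)

lemma Bn_inv_eq [simp]: "w \<in> Bn n \<Longrightarrow> inv w (w i) = i"
  by (simp add: Bn_bij bij_is_inj)

lemma Bn_eq_inv [simp]: "w \<in> Bn n \<Longrightarrow> w (inv w i) = i"
  by (simp add: Bn_bij bij_is_surj surj_f_inv_f)

lemma Bn_inv: "w \<in> Bn n \<Longrightarrow> inv w \<in> Bn n"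
  unfolding Bn_def
  by (auto simp: bij_imp_bij_inv bij_inv_eq_iff) (metis bij_inv_eq_iff)+

lemma Bn_comp: "v \<in> Bn n \<Longrightarrow> w \<in> Bn n \<Longrightarrow> v \<circ> w \<in> Bn n"
  unfolding Bn_def by (auto simp: bij_comp)

lemma Bn_id: "id \<in> Bn n"
  by (simp add: Bn_def)

lemma Bn_vals: 
  assumes "w \<in> Bn n" 
  shows "w a \<in> vals n \<longleftrightarrow> a \<in> vals n"
  using Bn_out [OF assms] Bn_out [OF Bn_inv [OF assms]] Bn_inv_eq [OF assms] by metis

lemma Bn_odd_key: "w \<in> Bn n \<Longrightarrow> odd_key n w"
  unfolding odd_key_def using Bn_bij [of w n] Bn_uminus [of w n]
  by (metis bij_is_inj inj_on_subset subset_UNIV)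

lemma invs_biclosed: "w \<in> Bn n \<Longrightarrow> biclosed n (invs n w)"
  by (intro kinv_biclosed Bn_odd_key Bn_inv)

lemma tr_tr: "a \<noteq> 0 \<Longrightarrow> c \<noteq> 0 \<Longrightarrow> tr a c (tr a c x) = x"
  by (auto simp: tr_def)

lemma tr_uminus: "a \<noteq> 0 \<Longrightarrow> c \<noteq> 0 \<Longrightarrow> tr a c (- x) = - tr a c x"
  by (auto simp: tr_def)

lemma tr_Bn: "a \<in> vals n \<Longrightarrow> c \<in> vals n \<Longrightarrow> tr a c \<in> Bn n"
  unfolding Bn_def
proof (safe)
  assume *: "a \<in> vals n" "c \<in> vals n"
  then have "a \<noteq> 0" "c \<noteq> 0" by (auto simp: vals_def)
  then show "bij (tr a c)" "\<And>i. tr a c (- i) = - tr a c i"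
    using tr_tr tr_uminus by (auto intro!: o_bij [of "tr a c"])
qed (auto simp: tr_def vals_def)

lemma inv_tr: "a \<in> vals n \<Longrightarrow> c \<in> vals n \<Longrightarrow> inv (tr a c) = tr a c"
  by (rule inv_unique_comp) (auto simp: tr_tr vals_def)

lemma tr_conj:
  assumes "u \<in> Bn n"
  shows "u \<circ> tr a c \<circ> inv u = tr (u a) (u c)"
proof
  fix x
  have inj: "u y = u z \<longleftrightarrow> y = z" for y z
    using assms by (metis Bn_inv_eq)
  have "u (tr a c y) = tr (u a) (u c) (u y)" for y
    by (simp add: tr_def inj Bn_uminus [OF assms, symmetric])
  from this [of "inv u x"] show "(u \<circ> tr a c \<circ> inv u) x = tr (u a) (u c) x"
    using assms by simp
qed

lemma gen_tr: "gen i = (if i = 0 then tr (- 1) 1 else tr (int i) (int i + 1))"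
  by (rule ext) (auto simp: gen_def tr_def)

lemma gen_Bn: "i < n \<Longrightarrow> gen i \<in> Bn n"
  unfolding gen_tr by (auto intro!: tr_Bn simp: vals_def)

lemma inv_comp_Bn: "v \<in> Bn n \<Longrightarrow> w \<in> Bn n \<Longrightarrow> inv (v \<circ> w) = inv w \<circ> inv v"
  by (simp add: Bn_bij o_inv_distrib)

lemma inv_gen: "inv (gen i) = gen i"
  unfolding gen_tr using inv_tr [of "-1" 1 1] inv_tr [of "int i" "i+1" "int i + 1"]
  by (auto simp: vals_def)

lemma gen_gen: "gen i \<circ> gen i = id"
  unfolding gen_tr by (auto simp: tr_tr fun_eq_iff)

text \<open>A linear order on the values that is compatible with negation is realised by the signed
  permutation reading off ranks; the jump at \<^term>\<open>n\<close> skips the position 0.\<close>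

definition rank_pos :: "nat \<Rightarrow> nat \<Rightarrow> int" where
  "rank_pos n j = (if j \<le> n then int j - int n - 1 else int j - int n)"

lemma card_vals: "card (vals n) = 2 * n"
proof -
  have "vals n = {- int n..int n} - {0}" by (auto simp: vals_def)
  then show ?thesis by simp
qed

lemma biclosed_invs:
  assumes X: "biclosed n X"
  shows "\<exists>w \<in> Bn n. invs n w = X"
proof -
  \<comment> \<open>The arrangement of the values in which exactly the pairs of \<open>X\<close> are
    out of order.\<close>
  define before where "before d a \<longleftrightarrow> (d < a \<and> (d, a) \<notin> X) \<or> (a < d \<and> (a, d) \<in> X)" for d a
  have total: "before d a \<or> before a d" if "a \<noteq> d" for a d
    using that by (auto simp: before_def)
  have asym: "\<not> before a d" if "before d a" for a d
    using that by (auto simp: before_def)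
  have trans: "before a c" if abc: "before a b" "before b c" "a \<in> vals n" "b \<in> vals n" "c \<in> vals n" for a b c
  proof -
    \<comment> \<open>For each relative order of three distinct values, closedness of
      \<open>X\<close> or of its complement rules out a cyclic arrangement.\<close>
    consider "a < b" "b < c" | "a < c" "c < b" | "b < a" "a < c" | "b < c" "c < a"
      | "c < a" "a < b" | "c < b" "b < a" | "a = c"
    proof -
      have "a \<noteq> b" "b \<noteq> c" using abc by (auto simp: before_def)
      then have "(a < b \<and> b < c) \<or> (a < c \<and> c < b) \<or> (b < a \<and> a < c) \<or> (b < c \<and> c < a) \<or>
          (c < a \<and> a < b) \<or> (c < b \<and> b < a) \<or> a = c" by linarith
      then show thesis using that by blast
    qed
    then show ?thesis
    proof cases
      case 1
      then show ?thesis using abc biclosed_split [OF X, of a c b] by (auto simp: before_def)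
    next
      case 2
      then show ?thesis using abc biclosed_trans [OF X, of a c b] by (auto simp: before_def)
    next
      case 3
      then show ?thesis using abc biclosed_trans [OF X, of b a c] by (auto simp: before_def)
    next
      case 4
      then show ?thesis using abc biclosed_split [OF X, of b a c] by (auto simp: before_def)
    next
      case 5
      then show ?thesis using abc biclosed_split [OF X, of c b a] by (auto simp: before_def)
    next
      case 6
      then show ?thesis using abc biclosed_trans [OF X, of c b a] by (auto simp: before_def)
    next
      case 7
      then show ?thesis using abc asym by blast
    qed
  qed
  have sym: "before (- a) (- d) \<longleftrightarrow> before d a" for a d
    unfolding before_def using biclosed_sym [OF X, of a d] biclosed_sym [OF X, of d a] by auto
  define S where "S a = {d \<in> vals n. d = a \<or> before d a}" for a
  define T where "T a = {d \<in> vals n. before a d}" for a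
  define p where "p a = (if a \<in> vals n then rank_pos n (card (S a)) else a)" for a
  have finS: "finite (S a)" "finite (T a)" for a by (auto simp: S_def T_def)
  have part: "card (S a) + card (T a) = 2 * n" if "a \<in> vals n" for a
  proof -
    have "S a \<union> T a = vals n" "S a \<inter> T a = {}"
      using that total asym by (auto simp: S_def T_def before_def)
    then show ?thesis using card_Un_disjoint [OF finS(1) finS(2), of a a] by (simp add: card_vals)
  qed
  \<comment> \<open>Negation reverses the arrangement, so \<open>- a\<close> has rank
    \<open>2 * n + 1 - card (S a)\<close>, and \<open>rank_pos\<close> turns this into an exact
    change of sign.\<close>
  have Sneg: "card (S (- a)) = card (T a) + 1" if "a \<in> vals n" for a
  proof -
    have "S (- a) = uminus ` (insert a (T a))"
    proof (rule set_eqI)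
      fix d
      have "d \<in> uminus ` (insert a (T a)) \<longleftrightarrow> - d \<in> insert a (T a)"
        by (metis (no_types, lifting) image_iff minus_minus)
      also have "\<dots> \<longleftrightarrow> d \<in> S (- a)"
        using that sym [of d a] sym [of "-d" a] by (auto simp: S_def T_def)
      finally show "d \<in> S (- a) \<longleftrightarrow> d \<in> uminus ` (insert a (T a))" by simp
    qed
    moreover have "a \<notin> T a" by (auto simp: T_def before_def)
    ultimately show ?thesis
      using finS(2) [of a] card_image [of uminus "insert a (T a)"] by (simp add: inj_on_def del: image_insert)
  qed
  have less: "card (S a) < card (S b)" if "before a b" "a \<in> vals n" "b \<in> vals n" for a b
  proof (rule psubset_card_mono [OF finS(1)])
    have "b \<notin> S a" using that asym by (auto simp: S_def before_def)
    moreover have "b \<in> S b" using that by (auto simp: S_def)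
    ultimately show "S a \<subset> S b"
      using that trans unfolding S_def by blast
  qed
  have pos: "card (S a) \<ge> 1" "card (S a) \<le> 2 * n" if "a \<in> vals n" for a
  proof -
    have "a \<in> S a" using that by (auto simp: S_def)
    then show "card (S a) \<ge> 1" using finS by (metis One_nat_def Suc_leI card_gt_0_iff empty_iff)
    show "card (S a) \<le> 2 * n" using part [OF that] by simp
  qed
  have p_less: "p a < p b" if "before a b" "a \<in> vals n" "b \<in> vals n" for a b
    using less [OF that] that by (auto simp: p_def rank_pos_def)
  have p_inj: "inj_on p (vals n)"
    by (rule inj_onI) (metis p_less total less_irrefl)
  have p_vals: "p a \<in> vals n" if "a \<in> vals n" for a
    using pos [OF that] that by (auto simp: p_def rank_pos_def vals_def)
  have p_bij_vals: "bij_betw p (vals n) (vals n)"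
    unfolding bij_betw_def using p_inj p_vals by (metis endo_inj_surj finite_vals image_subsetI)
  have "bij_betw p (- vals n) (- vals n)"
    unfolding bij_betw_def inj_on_def by (auto simp: p_def)
  then have "bij_betw p (vals n \<union> - vals n) (vals n \<union> - vals n)"
    using p_bij_vals by (intro bij_betw_combine) auto
  then have p_bij: "bij p" by simp
  have p_neg: "p (- a) = - p a" for a
    using Sneg [of a] part [of a] pos [of a] by (auto simp: p_def rank_pos_def)
  have p_Bn: "p \<in> Bn n"
    using p_bij p_neg by (auto simp: Bn_def) (auto simp: p_def vals_def)
  have "kinv n p = X"
  proof (rule set_eqI, clarify)
    fix a c
    show "(a, c) \<in> kinv n p \<longleftrightarrow> (a, c) \<in> X"
      using biclosed_roots [OF X, of a c] p_less [of a c] p_less [of c a]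
      unfolding kinv_iff before_def by fastforce
  qed
  \<comment> \<open>\<open>p\<close> sends values to positions, so the permutation sought is its
    inverse.\<close>
  then have "invs n (inv p) = X" using p_bij by (simp add: inv_inv_eq)
  then show ?thesis using Bn_inv [OF p_Bn] by blast
qed

text \<open>The inversions tell how many values are placed at or before \<open>a\<close>, and this
  number determines the position of \<open>a\<close>.\<close>

lemma invs_inject:
  assumes v: "v \<in> Bn n" and w: "w \<in> Bn n" and eq: "invs n v = invs n w"
  shows "v = w"
proof -
  define p q where "p = inv v" and "q = inv w"
  have pB: "p \<in> Bn n" and qB: "q \<in> Bn n" using v w by (auto simp: p_def q_def Bn_inv)
  have cmp: "p d \<le> p a \<longleftrightarrow> q d \<le> q a" if "a \<in> vals n" "d \<in> vals n" for a d
  proof -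
    have "(a, d) \<in> kinv n p \<longleftrightarrow> (a, d) \<in> kinv n q" "(d, a) \<in> kinv n p \<longleftrightarrow> (d, a) \<in> kinv n q"
      using eq by (simp_all add: p_def q_def)
    then show ?thesis
      using that odd_key_eq_iff [OF Bn_odd_key [OF pB]] odd_key_eq_iff [OF Bn_odd_key [OF qB]]
      unfolding kinv_iff by (metis linorder_neqE_linordered_idom linorder_not_le order_le_less)
  qed
  have img: "card {d \<in> vals n. r d \<le> k} = card {j \<in> vals n. j \<le> k}" if "r \<in> Bn n" for r k
  proof -
    have "{j \<in> vals n. j \<le> k} = r ` {d \<in> vals n. r d \<le> k}"
      using that Bn_vals [OF that] by (force simp: image_iff intro: exI [of _ "inv r _"])
    moreover have "inj_on r {d \<in> vals n. r d \<le> k}"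
      using Bn_bij [OF that] by (meson bij_is_inj inj_on_subset subset_UNIV)
    ultimately show ?thesis by (simp add: card_image)
  qed
  have mono: "card {j \<in> vals n. j \<le> k} < card {j \<in> vals n. j \<le> l}" if "k < l" "l \<in> vals n" for k l
  proof (rule psubset_card_mono)
    have "l \<in> {j \<in> vals n. j \<le> l}" "l \<notin> {j \<in> vals n. j \<le> k}" using that by auto
    moreover have "{j \<in> vals n. j \<le> k} \<subseteq> {j \<in> vals n. j \<le> l}" using that by auto
    ultimately show "{j \<in> vals n. j \<le> k} \<subset> {j \<in> vals n. j \<le> l}" by blast
  qed simp
  have "p a = q a" for a
  proof (cases "a \<in> vals n")
    case True
    have "{d \<in> vals n. p d \<le> p a} = {d \<in> vals n. q d \<le> q a}" using cmp True by auto
    then have "card {j \<in> vals n. j \<le> p a} = card {j \<in> vals n. j \<le> q a}"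
      using img [OF pB] img [OF qB] by metis
    then show ?thesis
      using mono [of "p a" "q a"] mono [of "q a" "p a"] Bn_vals [OF pB] Bn_vals [OF qB] True
      by (metis less_irrefl linorder_neqE_linordered_idom)
  next
    case False
    then show ?thesis using Bn_out pB qB by metis
  qed
  then have "inv v = inv w" by (auto simp: p_def q_def)
  then show ?thesis using v w by (metis Bn_bij inv_inv_eq)
qed


section \<open>The weak order as inclusion of inversion sets\<close>

lemma tr_commute: "tr a c = tr c a"
  by (auto simp: tr_def fun_eq_iff)

text \<open>No compared number lies strictly inside the gap from \<open>x\<close> to
  \<open>y\<close> or inside its mirror image, so the exchange moves \<open>x\<close> and
  \<open>y\<close> past nothing but each other.\<close>

lemma tr_less_iff_pos:
  fixes x y u v :: int
  assumes "0 < x" "x < y" "u \<noteq> v" 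
    and u: "u \<le> - y \<or> (- x \<le> u \<and> u \<le> x) \<or> y \<le> u" and v: "v \<le> - y \<or> (- x \<le> v \<and> v \<le> x) \<or> y \<le> v"
  shows "tr x y u < tr x y v \<longleftrightarrow>
    (if (u = x \<and> v = y) \<or> (u = y \<and> v = x) \<or> (u = - x \<and> v = - y) \<or> (u = - y \<and> v = - x)
     then \<not> u < v else u < v)"
proof -
  have 1: "tr x y w = (if w = - y then - x else w)" if "w \<le> - y" for w
    using that assms(1,2) by (auto simp: tr_def)
  have 2: "tr x y w = (if w = x then y else if w = - x then - y else w)" if "- x \<le> w \<and> w \<le> x" for w
    using that assms(1,2) by (auto simp: tr_def)
  have 3: "tr x y w = (if w = y then x else w)" if "y \<le> w" for w
    using that assms(1,2) by (auto simp: tr_def)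
  show ?thesis
    using u
  proof (elim disjE)
    assume u: "u \<le> - y"
    show ?thesis using v
      by (elim disjE; use assms(1-3) u in \<open>simp add: 1 2 3\<close>)
  next
    assume u: "- x \<le> u \<and> u \<le> x"
    show ?thesis using v
      by (elim disjE; use assms(1-3) u in \<open>simp add: 1 2 3\<close>)
  next
    assume u: "y \<le> u"
    show ?thesis using v
      by (elim disjE; use assms(1-3) u in \<open>simp add: 1 2 3\<close>)
  qed
qed

lemma tr_less_iff:
  fixes x y u v :: int
  assumes xy: "x < y" and o: "0 < x \<or> y < 0 \<or> y = - x" and ne: "u \<noteq> v"
    and u: "u \<le> x \<or> y \<le> u" "u \<le> - y \<or> - x \<le> u" and v: "v \<le> x \<or> y \<le> v" "v \<le> - y \<or> - x \<le> v"
  shows "tr x y u < tr x y v \<longleftrightarrow>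
    (if (u = x \<and> v = y) \<or> (u = y \<and> v = x) \<or> (u = - x \<and> v = - y) \<or> (u = - y \<and> v = - x)
     then \<not> u < v else u < v)"
  using o
proof (elim disjE)
  assume x: "0 < x"
  show ?thesis
    by (rule tr_less_iff_pos [OF x xy ne]) (use u v x xy in linarith)+
next
  assume y: "y < 0"
  have "tr x y = tr (- y) (- x)" using xy y by (auto simp: tr_def fun_eq_iff)
  moreover have "tr (- y) (- x) u < tr (- y) (- x) v \<longleftrightarrow>
    (if (u = - y \<and> v = - x) \<or> (u = - x \<and> v = - y) \<or> (u = - (- y) \<and> v = - (- x)) \<or>
        (u = - (- x) \<and> v = - (- y)) then \<not> u < v else u < v)"
    by (rule tr_less_iff_pos) (use u v y xy ne in linarith)+
  ultimately show ?thesis by (simp add: disj_commute disj_left_commute)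
next
  assume y: "y = - x"
  have 1: "tr x y w = (if w = x then y else w)" if "w \<le> x" for w
    using that y xy by (auto simp: tr_def)
  have 2: "tr x y w = (if w = y then x else w)" if "y \<le> w" for w
    using that y xy by (auto simp: tr_def)
  show ?thesis
    using u(1) v(1) by (elim disjE; use xy y ne 1 [of u] 1 [of v] 2 [of u] 2 [of v] in auto)
qed

lemma kinv_swap:
  assumes k: "odd_key n k" and ac: "(a, c) \<in> roots n" and less: "k a < k c"
    and adj: "\<And>d. d \<in> vals n \<Longrightarrow> \<not> (k a < k d \<and> k d < k c)"
  shows "kinv n (k \<circ> tr a c) = kinv n k \<union> {(a, c), (- c, - a)}"
proof (rule set_eqI, clarify)
  fix e d
  have v: "a \<in> vals n" "c \<in> vals n" "a < c" using ac by (auto simp: roots_def)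
  have eq: "k x = k y \<longleftrightarrow> x = y" if "x \<in> vals n" "y \<in> vals n" for x y
    using odd_key_eq_iff [OF k that] .
  have neg: "k (- x) = - k x" if "x \<in> vals n" for x using odd_key_uminus [OF k that] .
  have nz: "k x \<noteq> 0" if "x \<in> vals n" for x
    using eq [of x "- x"] neg [of x] that vals_nz [OF that] by auto
  \<comment> \<open>Adjacent keys of different sign must be opposite, since otherwise
    \<open>- k a\<close> or \<open>- k c\<close> would fall strictly between them.\<close>
  have o: "0 < k a \<or> k c < 0 \<or> k c = - k a"
  proof (rule ccontr)
    assume *: "\<not> ?thesis"
    then have "k a < 0" "0 < k c" using nz [OF v(1)] nz [OF v(2)] by auto
    then show False
      using * less adj [of "- a"] adj [of "- c"] v neg by (cases "- k a < k c") auto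
  qed
  have adj': "\<not> (k a < - k d \<and> - k d < k c)" if "d \<in> vals n" for d
    using adj [of "- d"] neg [OF that] that by auto
  \<comment> \<open>Exchanging values amounts to exchanging their keys, which reduces the claim to a
    comparison of integers.\<close>
  have kt: "k (tr a c x) = tr (k a) (k c) (k x)" if "x \<in> vals n" for x
    using that v eq [of x a] eq [of x c] eq [of x "- a"] eq [of x "- c"]
    by (simp add: tr_def neg)
  show "(e, d) \<in> kinv n (k \<circ> tr a c) \<longleftrightarrow> (e, d) \<in> kinv n k \<union> {(a, c), (- c, - a)}"
  proof (cases "e \<in> vals n \<and> d \<in> vals n \<and> e < d")
    case False
    then show ?thesis using v by (auto simp: kinv_iff)
  next
    case True
    have swap: "tr (k a) (k c) (k d) < tr (k a) (k c) (k e) \<longleftrightarrow>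
        (if (k d = k a \<and> k e = k c) \<or> (k d = k c \<and> k e = k a) \<or> (k d = - k a \<and> k e = - k c)
            \<or> (k d = - k c \<and> k e = - k a) then \<not> k d < k e else k d < k e)"
    proof (rule tr_less_iff [OF less o])
      show "k d \<noteq> k e" using True eq by auto
    qed (use True adj [of d] adj [of e] adj' [of d] adj' [of e] in linarith)+
    have eqs: "k x = - k y \<longleftrightarrow> x = - y" if "x \<in> vals n" "y \<in> vals n" for x y
      using eq [of x "- y"] neg that by simp
    show ?thesis
      using True v less by (auto simp: kinv_iff kt swap eq eqs neg)
  qed
qed

lemma odd_key_tr:
  assumes "odd_key n k" "a \<in> vals n" "c \<in> vals n"
  shows "odd_key n (k \<circ> tr a c)"
proof -
  have B: "tr a c \<in> Bn n" using assms by (simp add: tr_Bn)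
  have "inj_on k (tr a c ` vals n)"
    using assms(1) Bn_vals [OF B] by (auto simp: odd_key_def inj_on_def)
  then have "inj_on (k \<circ> tr a c) (vals n)"
    using comp_inj_on [of "tr a c" "vals n" k] Bn_odd_key [OF B] by (auto simp: odd_key_def)
  then show ?thesis
    using assms(1) Bn_vals [OF B] Bn_uminus [OF B] by (auto simp: odd_key_def)
qed

section \<open>Words, length and reflections\<close>

lemma word_prod_Nil [simp]: "word_prod [] = id"
  by (simp add: word_prod_def)

lemma word_prod_Cons [simp]: "word_prod (i # ws) = gen i \<circ> word_prod ws"
  by (simp add: word_prod_def)

lemma word_prod_append: "word_prod (us @ ws) = word_prod us \<circ> word_prod ws"
  by (induction us) auto

lemma is_word_simps [simp]: "is_word n []" "is_word n (i # ws) \<longleftrightarrow> i < n \<and> is_word n ws"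
  "is_word n (us @ ws) \<longleftrightarrow> is_word n us \<and> is_word n ws"
  by (auto simp: is_word_def)

lemma word_prod_Bn: "is_word n ws \<Longrightarrow> word_prod ws \<in> Bn n"
  by (induction ws) (simp_all add: Bn_id Bn_comp gen_Bn)

lemma gen_flip:
  assumes "a < c" "a \<noteq> 0" "c \<noteq> 0" "gen i c < gen i a"
  shows "tr a c = gen i"
proof (cases "i = 0")
  case True
  then have "a = - 1 \<and> c = 1" using assms by (auto simp: gen_def split: if_splits)
  then show ?thesis using True by (simp add: gen_tr)
next
  case False
  have "gen i a \<le> a + 1 \<and> (gen i a = a + 1 \<longrightarrow> a = int i \<or> a = - int i - 1)"
       "gen i c \<ge> c - 1 \<and> (gen i c = c - 1 \<longrightarrow> c = int i + 1 \<or> c = - int i)"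
    using False by (simp_all add: gen_def)
  then have "(a = int i \<and> c = int i + 1) \<or> (a = - int i - 1 \<and> c = - int i)"
    using assms by linarith
  then show ?thesis using False by (auto simp: gen_tr) (auto simp: tr_def fun_eq_iff)
qed

text \<open>Along the prefixes of a word the relative position of two values changes at a letter
  whose deletion multiplies the word by the corresponding reflection.\<close>

lemma exchange:
  assumes "is_word n ws" "(a, c) \<in> invs n (word_prod ws)"
  shows "tr a c \<in> reflections n \<and>
    (\<exists>us. is_word n us \<and> length us < length ws \<and> word_prod us = tr a c \<circ> word_prod ws)"
  using assms
proof (induction ws arbitrary: a c)
  case Nil
  then show ?case by (auto simp: kinv_iff inv_id)
next
  case (Cons i ws)
  define w where "w = word_prod ws"
  have i: "i < n" "gen i \<in> Bn n" and w: "w \<in> Bn n"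
    using Cons.prems by (simp_all add: gen_Bn w_def word_prod_Bn)
  have inv_eq: "inv (gen i \<circ> w) x = inv w (gen i x)" for x
    using inv_comp_Bn [OF i(2) w] by (simp add: inv_gen)
  have ac: "a \<in> vals n" "c \<in> vals n" "a < c" "inv w (gen i c) < inv w (gen i a)"
    using Cons.prems(2) unfolding word_prod_Cons w_def [symmetric] kinv_iff inv_eq by auto
  show ?case
  proof (cases "gen i c < gen i a")
    case True
    then have t: "tr a c = gen i" using gen_flip ac vals_nz by blast
    have "tr a c \<circ> word_prod (i # ws) = word_prod ws"
      by (simp add: t gen_gen comp_assoc [symmetric])
    moreover have "gen i \<in> reflections n"
      unfolding reflections_def using i(1) Bn_id by (force intro: exI [of _ id] simp: inv_id)
    ultimately show ?thesis using Cons.prems(1) t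
      by (intro conjI exI [of _ ws]) (auto simp del: word_prod_Cons)
  next
    case False
    \<comment> \<open>The first letter keeps the order of the two values, so the tail inverts their
      images. Conjugation by the letter carries the reflection found for the tail back to
      \<open>tr a c\<close>.\<close>
    define a' c' where "a' = gen i a" and "c' = gen i c"
    have "a' \<noteq> c'" using ac(4) by (auto simp: a'_def c'_def)
    then have "(a', c') \<in> invs n (word_prod ws)"
      using False ac Bn_vals [OF i(2)] by (auto simp: kinv_iff a'_def c'_def w_def)
    then obtain us where us: "tr a' c' \<in> reflections n" "is_word n us" "length us < length ws"
        "word_prod us = tr a' c' \<circ> word_prod ws"
      using Cons.IH Cons.prems(1) by (metis is_word_simps(2))
    have conj: "gen i \<circ> tr a' c' \<circ> gen i = tr a c"
      using tr_conj [OF i(2), of a' c'] gen_gen [of i]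
      by (simp add: inv_gen a'_def c'_def fun_eq_iff)
    have "tr a c \<circ> word_prod (i # ws) = gen i \<circ> tr a' c' \<circ> (gen i \<circ> gen i) \<circ> word_prod ws"
      unfolding conj [symmetric] by (simp add: comp_assoc)
    then have "word_prod (i # us) = tr a c \<circ> word_prod (i # ws)"
      using us(4) by (simp add: gen_gen comp_assoc)
    moreover have "tr a c \<in> reflections n"
    proof -
      obtain u j where u: "tr a' c' = u \<circ> gen j \<circ> inv u" "u \<in> Bn n" "j < n"
        using us(1) unfolding reflections_def by auto
      have "tr a c = (gen i \<circ> u) \<circ> gen j \<circ> inv (gen i \<circ> u)"
        unfolding conj [symmetric] u(1) inv_comp_Bn [OF i(2) u(2)] inv_gen by (simp add: comp_assoc)
      then show ?thesis
        unfolding reflections_def using Bn_comp [OF i(2) u(2)] u(3) by blast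
    qed
    ultimately show ?thesis using us i by (intro conjI exI [of _ "i # us"]) auto
  qed
qed

lemma adjacent_gen:
  assumes "x \<in> vals n" "y \<in> vals n" "x < y" "\<And>z. z \<in> vals n \<Longrightarrow> \<not> (x < z \<and> z < y)"
  shows "\<exists>i < n. gen i = tr x y"
proof -
  have xy: "x \<noteq> 0" "- int n \<le> x" "y \<noteq> 0" "y \<le> int n" using assms by (auto simp: vals_def)
  have "x + 1 \<in> vals n" if "x \<noteq> - 1" using that xy assms(3) by (auto simp: vals_def)
  then have 1: "y \<le> x + 1" if "x \<noteq> - 1" using assms(4) [of "x + 1"] that by linarith
  have "1 \<in> vals n" if "x = - 1" using that xy by (auto simp: vals_def)
  then have 2: "y \<le> 1" if "x = - 1" using assms(4) [of 1] that by linarith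
  consider "x = - 1" "y = 1" | "x > 0" "y = x + 1" | "x < - 1" "y = x + 1"
    using 1 2 xy assms(3) by fastforce
  then show ?thesis
  proof cases
    case 1
    then show ?thesis using assms(1) by (intro exI [of _ 0]) (auto simp: gen_tr vals_def)
  next
    case 2
    then show ?thesis using assms(2) by (intro exI [of _ "nat x"]) (auto simp: gen_tr vals_def)
  next
    case 3
    then show ?thesis using assms(1)
      by (intro exI [of _ "nat (- x - 1)"]) (auto simp: gen_def tr_def vals_def fun_eq_iff)
  qed
qed

text \<open>Take an inversion with the smallest difference of keys: a value placed inside it would
  form a smaller inversion with \<open>a\<close> or with \<open>c\<close>.\<close>

lemma adjacent_inversion:
  assumes p: "odd_key n p" and ne: "kinv n p \<noteq> {}"
  shows "\<exists>a c. (a, c) \<in> kinv n p \<and> (\<forall>d \<in> vals n. \<not> (p c < p d \<and> p d < p a))"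
proof -
  define m where "m r = nat (p (fst r) - p (snd r))" for r
  obtain r0 where "r0 \<in> kinv n p" using ne by blast
  then obtain r where "r \<in> kinv n p" "\<And>s. s \<in> kinv n p \<Longrightarrow> m r \<le> m s"
    using ex_has_least_nat [of "\<lambda>r. r \<in> kinv n p" r0 m] by blast
  then obtain a c where ac: "(a, c) \<in> kinv n p"
    and min': "\<And>e d. (e, d) \<in> kinv n p \<Longrightarrow> nat (p a - p c) \<le> nat (p e - p d)"
    unfolding m_def by (metis fst_conv prod.collapse snd_conv)
  have min: "p a - p c \<le> p e - p d" if "(e, d) \<in> kinv n p" for e d
    using min' [OF that] that by (auto simp: kinv_iff)
  have False if "d \<in> vals n" "p c < p d" "p d < p a" for d
    using that min [of d c] min [of a d] ac by (cases "d < c") (auto simp: kinv_iff)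
  then show ?thesis using ac by blast
qed

text \<open>Undoing an inversion between neighbouring positions is right multiplication by a
  generator and lowers the number of inversions. It follows that the minimum in \<open>len\<close>
  is attained.\<close>

lemma Bn_word: "w \<in> Bn n \<Longrightarrow> \<exists>ws. is_word n ws \<and> word_prod ws = w"
proof (induction "card (invs n w)" arbitrary: w rule: less_induct)
  case less
  show ?case
  proof (cases "invs n w = {}")
    case True
    have "invs n id = {}" by (auto simp: kinv_def roots_def inv_id)
    with True have "w = id" using invs_inject [OF less.prems Bn_id] by simp
    then show ?thesis by (auto intro: exI [of _ "[]"])
  next
    case False
    define p where "p = inv w"
    have pB: "p \<in> Bn n" and k: "odd_key n p" using less.prems by (auto simp: p_def Bn_inv Bn_odd_key)
    obtain a c where ac: "(a, c) \<in> kinv n p" "\<And>d. d \<in> vals n \<Longrightarrow> \<not> (p c < p d \<and> p d < p a)"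
      using adjacent_inversion [OF k] False by (auto simp: p_def)
    have v: "a \<in> vals n" "c \<in> vals n" "a < c" "p c < p a" using ac(1) by (auto simp: kinv_iff)
    have "\<not> (p c < z \<and> z < p a)" if "z \<in> vals n" for z
      using ac(2) [of "w z"] that Bn_vals [OF less.prems] less.prems by (auto simp: p_def)
    then obtain i where i: "i < n" "gen i = tr (p c) (p a)"
      using adjacent_gen [of "p c" n "p a"] v Bn_vals [OF pB] by blast
    define u where "u = w \<circ> gen i"
    have u: "u \<in> Bn n" unfolding u_def by (intro Bn_comp less.prems gen_Bn i)
    have "w \<circ> gen i \<circ> inv w = tr a c"
      using tr_conj [OF less.prems, of "p a" "p c"] less.prems
      unfolding i(2) tr_commute [of "p c"] by (simp add: p_def)
    then have ut: "u = tr a c \<circ> w"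
      using less.prems unfolding u_def comp_def fun_eq_iff by (metis Bn_inv_eq)
    then have "inv u = p \<circ> tr a c"
      using inv_comp_Bn [OF tr_Bn [OF v(1,2)] less.prems] v by (simp add: inv_tr p_def)
    then have pu: "p = inv u \<circ> tr a c"
      using v by (auto simp: fun_eq_iff tr_tr vals_nz)
    then have "p a = inv u c" "p c = inv u a" by (auto simp: tr_def)
    have "(a, c) \<notin> invs n u" using v \<open>p a = inv u c\<close> \<open>p c = inv u a\<close> by (auto simp: kinv_iff)
    moreover have "invs n w = invs n u \<union> {(a, c), (- c, - a)}"
    proof -
      have "\<not> (inv u a < inv u d \<and> inv u d < inv u c)" if "d \<in> vals n" for d
        using ac(2) [of "tr a c d"] that v Bn_vals [OF tr_Bn [OF v(1,2)]] 
          \<open>p a = inv u c\<close> \<open>p c = inv u a\<close> pu by (auto simp: tr_tr vals_nz)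
      then have "kinv n (inv u \<circ> tr a c) = invs n u \<union> {(a, c), (- c, - a)}"
        using kinv_swap [OF Bn_odd_key [OF Bn_inv [OF u]], of a c] v \<open>p a = inv u c\<close> \<open>p c = inv u a\<close>
        by (auto simp: roots_def)
      then show ?thesis using pu by (simp add: p_def)
    qed
    ultimately have "card (invs n u) < card (invs n w)"
      by (intro psubset_card_mono) auto
    then obtain us where us: "is_word n us" "word_prod us = u" using less.hyps u by blast
    have "word_prod (us @ [i]) = w" using us(2) by (simp add: word_prod_append u_def comp_assoc gen_gen)
    then show ?thesis using us(1) i(1) by (intro exI [of _ "us @ [i]"]) simp
  qed
qed

lemma len_le: "is_word n ws \<Longrightarrow> len n (word_prod ws) \<le> length ws"
  unfolding len_def by (rule Least_le) auto

lemma len_word: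
  assumes "w \<in> Bn n"
  obtains ws where "is_word n ws" "length ws = len n w" "word_prod ws = w"
proof -
  have "\<exists>k ws. is_word n ws \<and> length ws = k \<and> word_prod ws = w"
    using Bn_word [OF assms] by auto
  from LeastI_ex [OF this] show ?thesis using that unfolding len_def by blast
qed

lemma len_tr_less:
  assumes w: "w \<in> Bn n" and ac: "(a, c) \<in> invs n w"
  shows "tr a c \<in> reflections n" "len n (tr a c \<circ> w) < len n w"
proof -
  obtain ws where ws: "is_word n ws" "length ws = len n w" "word_prod ws = w"
    using len_word [OF w] .
  from exchange [OF ws(1), of a c] ac ws obtain us where
    "tr a c \<in> reflections n" "is_word n us" "length us < len n w" "word_prod us = tr a c \<circ> w"
    by auto
  then show "tr a c \<in> reflections n" "len n (tr a c \<circ> w) < len n w"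
    using len_le [of n us] by auto
qed

text \<open>A pair not inverted by \<open>w\<close> is inverted by \<open>tr a c \<circ> w\<close>,
  and the drop in length from there back to \<open>w\<close> is a gain seen from
  \<open>w\<close>.\<close>

lemma tr_inv_set_iff:
  assumes w: "w \<in> Bn n" and ac: "(a, c) \<in> roots n"
  shows "tr a c \<in> inv_set n w \<longleftrightarrow> (a, c) \<in> invs n w"
proof
  show "tr a c \<in> inv_set n w" if "(a, c) \<in> invs n w"
    using len_tr_less [OF w that] by (simp add: inv_set_def)
  have v: "a \<in> vals n" "c \<in> vals n" "a < c" using ac by (auto simp: roots_def)
  have t: "tr a c \<in> Bn n" using v by (simp add: tr_Bn)
  show "(a, c) \<in> invs n w" if "tr a c \<in> inv_set n w"
  proof (rule ccontr)
    assume "(a, c) \<notin> invs n w"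
    then have "inv w a < inv w c"
      using v odd_key_eq_iff [OF Bn_odd_key [OF Bn_inv [OF w]], of a c] by (auto simp: kinv_iff)
    then have "(a, c) \<in> invs n (tr a c \<circ> w)"
      using v inv_comp_Bn [OF t w] by (auto simp: kinv_iff inv_tr) (auto simp: tr_def)
    from len_tr_less(2) [OF Bn_comp [OF t w] this]
    have "len n w < len n (tr a c \<circ> w)"
      using v by (simp add: tr_tr vals_nz comp_def)
    with that show False by (simp add: inv_set_def)
  qed
qed

lemma reflections_tr:
  assumes "t \<in> reflections n"
  obtains a c where "(a, c) \<in> roots n" "t = tr a c"
proof -
  obtain u i where u: "t = u \<circ> gen i \<circ> inv u" "u \<in> Bn n" "i < n"
    using assms by (auto simp: reflections_def)
  define x y where "x = (if i = 0 then - 1 else int i)" and "y = (if i = 0 then 1 else int i + 1)"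
  have xy: "gen i = tr x y" "x \<in> vals n" "y \<in> vals n" "x \<noteq> y"
    using u(3) by (auto simp: x_def y_def gen_tr vals_def)
  then have t: "t = tr (u x) (u y)" using u tr_conj by simp
  have "u x \<in> vals n" "u y \<in> vals n" "u x \<noteq> u y"
    using xy Bn_vals [OF u(2)] odd_key_eq_iff [OF Bn_odd_key [OF u(2)]] by auto
  moreover have "tr (u x) (u y) = tr (u y) (u x)" by (rule tr_commute)
  ultimately show ?thesis
    using that [of "u x" "u y"] that [of "u y" "u x"] t
    by (cases "u x < u y") (auto simp: roots_def)
qed

lemma wle_iff:
  assumes "v \<in> Bn n" "w \<in> Bn n"
  shows "wle n v w \<longleftrightarrow> invs n v \<subseteq> invs n w"
proof
  assume *: "wle n v w"
  show "invs n v \<subseteq> invs n w"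
  proof clarify
    fix a c
    assume "(a, c) \<in> invs n v"
    moreover from this have "(a, c) \<in> roots n" using kinv_subset by blast
    ultimately show "(a, c) \<in> invs n w"
      using * tr_inv_set_iff assms unfolding wle_def by blast
  qed
next
  assume *: "invs n v \<subseteq> invs n w"
  show "wle n v w"
    unfolding wle_def
  proof
    fix t
    assume t: "t \<in> inv_set n v"
    then have "t \<in> reflections n" by (simp add: inv_set_def)
    then obtain a c where "(a, c) \<in> roots n" "t = tr a c"
      using reflections_tr by blast
    then show "t \<in> inv_set n w" using t * tr_inv_set_iff assms by blast
  qed
qed


text \<open>Right multiplication by \<open>gen k\<close> exchanges the values in positions
  \<open>x\<close> and \<open>y\<close>, which are neighbours among the nonzero positions. This
  computes inversion sets of words letter by letter.\<close>

lemma invs_comp_gen: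
  assumes w: "w \<in> Bn n" and k: "k < n" and xy: "x = (if k = 0 then - 1 else int k)" "y = (if k = 0 then 1 else int k + 1)"
    and less: "w x < w y"
  shows "invs n (w \<circ> gen k) = invs n w \<union> {(w x, w y), (- w y, - w x)}"
proof -
  have g: "gen k = tr x y" and v: "x \<in> vals n" "y \<in> vals n" "x < y"
    using k by (auto simp: xy gen_tr vals_def)
  have wv: "w x \<in> vals n" "w y \<in> vals n" using v Bn_vals [OF w] by auto
  have "inv w \<circ> tr (w x) (w y) \<circ> inv (inv w) = tr x y"
    using tr_conj [OF Bn_inv [OF w], of "w x" "w y"] w by simp
  then have "tr x y \<circ> inv w = inv w \<circ> tr (w x) (w y)"
    using w by (simp add: fun_eq_iff inv_inv_eq Bn_bij) (metis Bn_eq_inv)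
  then have "inv (w \<circ> gen k) = inv w \<circ> tr (w x) (w y)"
    using inv_comp_Bn [OF w gen_Bn [OF k]] by (simp add: inv_gen) (simp add: g)
  moreover have "kinv n (inv w \<circ> tr (w x) (w y)) = invs n w \<union> {(w x, w y), (- w y, - w x)}"
  proof (rule kinv_swap [OF Bn_odd_key [OF Bn_inv [OF w]]])
    show "(w x, w y) \<in> roots n" using wv less by (simp add: roots_def)
    show "inv w (w x) < inv w (w y)" using w v by simp
    fix d assume "d \<in> vals n"
    then have "inv w d \<in> vals n" using Bn_vals [OF Bn_inv [OF w]] by simp
    then show "\<not> (inv w (w x) < inv w d \<and> inv w d < inv w (w y))"
      using w by (auto simp: xy vals_def split: if_splits)
  qed
  ultimately show ?thesis by simp
qed

section \<open>Meets and joins\<close>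

definition jn :: "(int \<times> int) set \<Rightarrow> (int \<times> int) set \<Rightarrow> (int \<times> int) set" where
  "jn X Y = (X \<union> Y)\<^sup>+"

text \<open>An intersection of biclosed sets need not be biclosed. Removing the closure of the union
  of the complements leaves its largest biclosed subset.\<close>

definition mt :: "nat \<Rightarrow> (int \<times> int) set \<Rightarrow> (int \<times> int) set \<Rightarrow> (int \<times> int) set" where
  "mt n X Y = roots n - jn (roots n - X) (roots n - Y)"

lemma biclosed_compl:
  assumes X: "biclosed n X"
  shows "biclosed n (roots n - X)"
proof (rule biclosedI)
  show "(- c, - a) \<in> roots n - X" if "(a, c) \<in> roots n - X" for a c
    using that biclosed_sym [OF X] by (simp add: roots_uminus)
  show "(a, c) \<in> roots n - X" if "(a, b) \<in> roots n - X" "(b, c) \<in> roots n - X" for a b c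
    using that biclosed_split [OF X, of a c b] by (auto simp: roots_def)
  show "(a, b) \<in> roots n - X \<or> (b, c) \<in> roots n - X"
    if "(a, c) \<in> roots n - X" "b \<in> vals n" "a < b" "b < c" for a b c
    using that biclosed_trans [OF X, of a b c] by (auto simp: roots_def)
qed blast

text \<open>The chain starts below \<open>b\<close> and ends above it, so some step leaves the
  values below \<open>b\<close>; it lands on \<open>b\<close> or jumps over it.\<close>

lemma trancl_crossing:
  fixes a b c :: int
  assumes "(a, c) \<in> R\<^sup>+" "a < b" "b < c"
  shows "(a, b) \<in> R\<^sup>+ \<and> (b, c) \<in> R\<^sup>+ \<or>
    (\<exists>d e. (a, d) \<in> R\<^sup>* \<and> (d, e) \<in> R \<and> (e, c) \<in> R\<^sup>* \<and> d < b \<and> b < e)"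
  using assms
proof (induction rule: trancl_induct)
  case (base c)
  then show ?case by blast
next
  case (step y z)
  consider "b < y" | "b = y" | "y < b" by linarith
  then show ?case
  proof cases
    case 1
    then show ?thesis
      using step.IH [OF step.prems(1)] step.hyps by (meson rtrancl.rtrancl_into_rtrancl trancl.trancl_into_trancl)
  next
    case 2
    then show ?thesis using step.hyps by blast
  next
    case 3
    then show ?thesis using step by (meson rtrancl.rtrancl_refl trancl_into_rtrancl)
  qed
qed

lemma jn_upper1: "X \<subseteq> jn X Y"
  by (auto simp: jn_def)

lemma jn_upper2: "Y \<subseteq> jn X Y"
  by (auto simp: jn_def)

lemma jn_trans: "(a, b) \<in> jn X Y \<Longrightarrow> (b, c) \<in> jn X Y \<Longrightarrow> (a, c) \<in> jn X Y"
  unfolding jn_def by (rule trancl_trans)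

lemma jn_least:
  assumes "biclosed n Z" "X \<subseteq> Z" "Y \<subseteq> Z"
  shows "jn X Y \<subseteq> Z"
proof -
  have "trans Z" using biclosed_trans [OF assms(1)] by (blast intro: transI)
  then have "Z\<^sup>+ = Z" by (rule trancl_id)
  then show ?thesis unfolding jn_def using trancl_mono [of _ "X \<union> Y" Z] assms by blast
qed

lemma jn_biclosed:
  assumes X: "biclosed n X" and Y: "biclosed n Y"
  shows "biclosed n (jn X Y)"
proof -
  define R where "R = X \<union> Y"
  have sub: "R \<subseteq> roots n" using assms by (auto simp: R_def biclosed_def)
  have "trans (roots n)" by (auto simp: trans_def roots_def)
  then have "R\<^sup>+ \<subseteq> roots n"
    using trancl_mono [OF _ sub] trancl_id by blast
  moreover have "(- c, - a) \<in> R\<^sup>+" if "(a, c) \<in> R\<^sup>+" for a c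
    using that
  proof (induction rule: trancl_induct)
    case (base c)
    then show ?case using biclosed_sym [OF X] biclosed_sym [OF Y] by (auto simp: R_def)
  next
    case (step y z)
    then have "(- z, - y) \<in> R" using biclosed_sym [OF X] biclosed_sym [OF Y] by (auto simp: R_def)
    then show ?case using step.IH by (rule trancl_into_trancl2)
  qed
  moreover have "(a, b) \<in> R\<^sup>+ \<or> (b, c) \<in> R\<^sup>+" if ac: "(a, c) \<in> R\<^sup>+" "b \<in> vals n" "a < b" "b < c" for a b c
  proof -
    have "(a, b) \<in> R\<^sup>+ \<or> (b, c) \<in> R\<^sup>+" if "(a, d) \<in> R\<^sup>*" "(d, e) \<in> R" "(e, c) \<in> R\<^sup>*" "d < b" "b < e" for d e
    proof -
      have "(d, b) \<in> R \<or> (b, e) \<in> R"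
        using that ac(2) biclosed_split [OF X, of d e b] biclosed_split [OF Y, of d e b] by (auto simp: R_def)
      then show ?thesis using that by (meson rtrancl_into_trancl1 rtrancl_into_trancl2)
    qed
    then show ?thesis using trancl_crossing [OF ac(1,3,4)] by blast
  qed
  ultimately show ?thesis
    unfolding jn_def R_def [symmetric] by (intro biclosedI) (auto intro: trancl_trans)
qed

lemma mt_biclosed: "biclosed n X \<Longrightarrow> biclosed n Y \<Longrightarrow> biclosed n (mt n X Y)"
  unfolding mt_def by (intro biclosed_compl jn_biclosed)

lemma mt_lower:
  assumes "biclosed n X" "biclosed n Y"
  shows "mt n X Y \<subseteq> X" "mt n X Y \<subseteq> Y"
proof -
  have "roots n - X \<subseteq> jn (roots n - X) (roots n - Y)" "roots n - Y \<subseteq> jn (roots n - X) (roots n - Y)"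
    by (rule jn_upper1 jn_upper2)+
  then show "mt n X Y \<subseteq> X" "mt n X Y \<subseteq> Y" unfolding mt_def by blast+
qed

lemma mt_greatest:
  assumes "biclosed n Z" "Z \<subseteq> X" "Z \<subseteq> Y"
  shows "Z \<subseteq> mt n X Y"
proof -
  have "jn (roots n - X) (roots n - Y) \<subseteq> roots n - Z"
    by (rule jn_least [OF biclosed_compl [OF assms(1)]]) (use assms in auto)
  then show ?thesis using biclosed_subset [OF assms(1)] by (auto simp: mt_def)
qed

lemma compl_jn: "biclosed n X \<Longrightarrow> biclosed n Y \<Longrightarrow> roots n - jn X Y = mt n (roots n - X) (roots n - Y)"
  unfolding mt_def using biclosed_subset [of n X] biclosed_subset [of n Y]
  by (simp add: double_diff)

lemma is_join_iff:
  assumes x: "x \<in> Bn n" and y: "y \<in> Bn n"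
  shows "is_join n x y j \<longleftrightarrow> j \<in> Bn n \<and> invs n j = jn (invs n x) (invs n y)"
proof -
  have bx: "biclosed n (invs n x)" and by': "biclosed n (invs n y)" using x y by (simp_all add: invs_biclosed)
  obtain m where m: "m \<in> Bn n" "invs n m = jn (invs n x) (invs n y)"
    using biclosed_invs [OF jn_biclosed [OF bx by']] by auto
  show ?thesis
  proof
    assume j: "is_join n x y j"
    then have jB: "j \<in> Bn n" by (simp add: is_join_def)
    have ub: "invs n x \<subseteq> invs n j" "invs n y \<subseteq> invs n j"
      using j wle_iff [OF x jB] wle_iff [OF y jB] by (simp_all add: is_join_def)
    have "wle n x m" "wle n y m"
      using m(2) jn_upper1 [of "invs n x" "invs n y"] jn_upper2 [of "invs n y" "invs n x"] wle_iff [OF x m(1)] wle_iff [OF y m(1)] by simp_all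
    then have "invs n j \<subseteq> invs n m" using j m(1) wle_iff [OF jB m(1)] by (simp add: is_join_def)
    then show "j \<in> Bn n \<and> invs n j = jn (invs n x) (invs n y)"
      using jB m(2) jn_least [OF invs_biclosed [OF jB] ub] by auto
  next
    assume j: "j \<in> Bn n \<and> invs n j = jn (invs n x) (invs n y)"
    then show "is_join n x y j"
      using x y jn_upper1 [of "invs n x" "invs n y"] jn_upper2 [of "invs n y" "invs n x"] jn_least [OF invs_biclosed]
      by (simp add: is_join_def wle_iff)
  qed
qed

lemma is_meet_iff:
  assumes x: "x \<in> Bn n" and y: "y \<in> Bn n"
  shows "is_meet n x y j \<longleftrightarrow> j \<in> Bn n \<and> invs n j = mt n (invs n x) (invs n y)"
proof -
  have bx: "biclosed n (invs n x)" and by': "biclosed n (invs n y)" using x y by (simp_all add: invs_biclosed)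
  obtain m where m: "m \<in> Bn n" "invs n m = mt n (invs n x) (invs n y)"
    using biclosed_invs [OF mt_biclosed [OF bx by']] by auto
  show ?thesis
  proof
    assume j: "is_meet n x y j"
    then have jB: "j \<in> Bn n" by (simp add: is_meet_def)
    have lb: "invs n j \<subseteq> invs n x" "invs n j \<subseteq> invs n y"
      using j wle_iff [OF jB x] wle_iff [OF jB y] by (simp_all add: is_meet_def)
    have "wle n m x" "wle n m y"
      using m(2) mt_lower [OF bx by'] wle_iff [OF m(1) x] wle_iff [OF m(1) y] by simp_all
    then have "invs n m \<subseteq> invs n j" using j m(1) wle_iff [OF m(1) jB] by (simp add: is_meet_def)
    then show "j \<in> Bn n \<and> invs n j = mt n (invs n x) (invs n y)"
      using jB m(2) mt_greatest [OF invs_biclosed [OF jB] lb] by auto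
  next
    assume j: "j \<in> Bn n \<and> invs n j = mt n (invs n x) (invs n y)"
    then show "is_meet n x y j"
      using x y mt_lower [OF bx by'] mt_greatest [OF invs_biclosed]
      by (simp add: is_meet_def wle_iff)
  qed
qed

section \<open>Aligned inversion sets and the congruence they define\<close>

definition skew :: "nat \<Rightarrow> (int \<Rightarrow> bool) \<Rightarrow> bool" where
  "skew n lo \<longleftrightarrow> (\<forall>b \<in> vals n. lo (- b) \<longleftrightarrow> \<not> lo b)"

definition aligned :: "nat \<Rightarrow> (int \<Rightarrow> bool) \<Rightarrow> (int \<times> int) set \<Rightarrow> bool" where
  "aligned n lo X \<longleftrightarrow> (\<forall>a b c. (a, c) \<in> X \<longrightarrow> b \<in> vals n \<longrightarrow> a < b \<longrightarrow> b < c \<longrightarrow>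
     (if lo b then (a, b) \<in> X else (b, c) \<in> X))"

lemma aligned_low:
  "aligned n lo X \<Longrightarrow> (a, c) \<in> X \<Longrightarrow> b \<in> vals n \<Longrightarrow> a < b \<Longrightarrow> b < c \<Longrightarrow> lo b \<Longrightarrow> (a, b) \<in> X"
  unfolding aligned_def by metis

lemma aligned_high:
  "aligned n lo X \<Longrightarrow> (a, c) \<in> X \<Longrightarrow> b \<in> vals n \<Longrightarrow> a < b \<Longrightarrow> b < c \<Longrightarrow> \<not> lo b \<Longrightarrow> (b, c) \<in> X"
  unfolding aligned_def by metis

text \<open>Alignment lets a low value replace the right end of a pair and a high value the left
  end. The pairs \<open>(a', c')\<close> are those obtained from \<open>(a, c)\<close> by such
  replacements, so this is a closed form of the largest aligned part of \<open>X\<close>.\<close>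

definition down :: "nat \<Rightarrow> (int \<Rightarrow> bool) \<Rightarrow> (int \<times> int) set \<Rightarrow> (int \<times> int) set" where
  "down n lo X = {(a, c) \<in> X. \<forall>a' c'. a' \<in> vals n \<longrightarrow> c' \<in> vals n \<longrightarrow> a \<le> a' \<longrightarrow> a' < c' \<longrightarrow> c' \<le> c \<longrightarrow>
     (a' = a \<or> \<not> lo a') \<longrightarrow> (c' = c \<or> lo c') \<longrightarrow> (a', c') \<in> X}"

lemma down_subset: "down n lo X \<subseteq> X"
  by (auto simp: down_def)

lemma down_mono: "X \<subseteq> Y \<Longrightarrow> down n lo X \<subseteq> down n lo Y"
  unfolding down_def by blast

lemma downD:
  "(a, c) \<in> down n lo X \<Longrightarrow> a' \<in> vals n \<Longrightarrow> c' \<in> vals n \<Longrightarrow> a \<le> a' \<Longrightarrow> a' < c' \<Longrightarrow> c' \<le> c \<Longrightarrow>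
     a' = a \<or> \<not> lo a' \<Longrightarrow> c' = c \<or> lo c' \<Longrightarrow> (a', c') \<in> X"
  by (auto simp: down_def)

lemma down_aligned:
  assumes X: "biclosed n X"
  shows "aligned n lo (down n lo X)"
  unfolding aligned_def
proof (intro allI impI)
  fix a b c
  assume ac: "(a, c) \<in> down n lo X" and b: "b \<in> vals n" "a < b" "b < c"
  have v: "a \<in> vals n" "c \<in> vals n" using ac down_subset biclosed_roots [OF X] by blast+
  show "if lo b then (a, b) \<in> down n lo X else (b, c) \<in> down n lo X"
  proof (cases "lo b")
    case True
    have "(a', c') \<in> X" if "a' \<in> vals n" "c' \<in> vals n" "a \<le> a'" "a' < c'" "c' \<le> b"
      "a' = a \<or> \<not> lo a'" "c' = b \<or> lo c'" for a' c'
      by (rule downD [OF ac]) (use that b True in auto)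
    moreover have "(a, b) \<in> X" by (rule downD [OF ac]) (use b v True in auto)
    ultimately show ?thesis using True by (auto simp: down_def)
  next
    case False
    have "(a', c') \<in> X" if "a' \<in> vals n" "c' \<in> vals n" "b \<le> a'" "a' < c'" "c' \<le> c"
      "a' = b \<or> \<not> lo a'" "c' = c \<or> lo c'" for a' c'
      by (rule downD [OF ac]) (use that b False in auto)
    moreover have "(b, c) \<in> X" by (rule downD [OF ac]) (use b v False in auto)
    ultimately show ?thesis using False by (auto simp: down_def)
  qed
qed

lemma down_biclosed:
  assumes lo: "skew n lo" and X: "biclosed n X"
  shows "biclosed n (down n lo X)"
proof -
  have sym: "(- c, - a) \<in> down n lo X" if ac: "(a, c) \<in> down n lo X" for a c
  proof -
    have "(a', c') \<in> X" if *: "a' \<in> vals n" "c' \<in> vals n" "- c \<le> a'" "a' < c'" "c' \<le> - a"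
      "a' = - c \<or> \<not> lo a'" "c' = - a \<or> lo c'" for a' c'
    proof -
      \<comment> \<open>Negation exchanges the colours, hence also the two kinds of
        replacement.\<close>
      have "lo (- c') \<longleftrightarrow> \<not> lo c'" "lo (- a') \<longleftrightarrow> \<not> lo a'"
        using * lo by (simp_all add: skew_def)
      then have "(- c', - a') \<in> X"
        by (intro downD [OF ac]) (use * in auto)
      then show ?thesis using biclosed_sym [OF X] by simp
    qed
    moreover have "(- c, - a) \<in> X" using ac down_subset biclosed_sym [OF X] by blast
    ultimately show ?thesis by (auto simp: down_def)
  qed
  have trans: "(a, c) \<in> down n lo X" if ab: "(a, b) \<in> down n lo X" and bc: "(b, c) \<in> down n lo X" for a b c
  proof -
    have v: "a \<in> vals n" "b \<in> vals n" "c \<in> vals n" "a < b" "b < c"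
      using ab bc down_subset biclosed_roots [OF X] by blast+
    have "(a', c') \<in> X" if *: "a' \<in> vals n" "c' \<in> vals n" "a \<le> a'" "a' < c'" "c' \<le> c"
      "a' = a \<or> \<not> lo a'" "c' = c \<or> lo c'" for a' c'
    proof -
      \<comment> \<open>A pair derived from \<open>(a, c)\<close> lies on one side of
        \<open>b\<close> or is cut by \<open>b\<close> into pairs derived from \<open>(a, b)\<close>
        and \<open>(b, c)\<close>.\<close>
      consider "c' \<le> b" | "b \<le> a'" | "a' < b" "b < c'" by linarith
      then show ?thesis
      proof cases
        case 1
        show ?thesis by (rule downD [OF ab]) (use * 1 v in auto)
      next
        case 2
        show ?thesis by (rule downD [OF bc]) (use * 2 v in auto)
      next
        case 3
        have "(a', b) \<in> X" by (rule downD [OF ab]) (use * 3 v in auto)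
        moreover have "(b, c') \<in> X" by (rule downD [OF bc]) (use * 3 v in auto)
        ultimately show ?thesis using biclosed_trans [OF X] by blast
      qed
    qed
    moreover have "(a, c) \<in> X" using ab bc down_subset biclosed_trans [OF X] by blast
    ultimately show ?thesis by (auto simp: down_def)
  qed
  have "(a, b) \<in> down n lo X \<or> (b, c) \<in> down n lo X"
    if "(a, c) \<in> down n lo X" "b \<in> vals n" "a < b" "b < c" for a b c
    using aligned_low [OF down_aligned [OF X] that] aligned_high [OF down_aligned [OF X] that] by blast
  then show ?thesis
    using sym trans down_subset [of n lo X] biclosed_subset [OF X] by (intro biclosedI) auto
qed

lemma down_greatest:
  assumes Y: "biclosed n Y" "aligned n lo Y" "Y \<subseteq> X"
  shows "Y \<subseteq> down n lo X"
proof clarify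
  fix a c
  assume ac: "(a, c) \<in> Y"
  have "(a', c') \<in> Y" if *: "a' \<in> vals n" "c' \<in> vals n" "a \<le> a'" "a' < c'" "c' \<le> c"
    "a' = a \<or> \<not> lo a'" "c' = c \<or> lo c'" for a' c'
  proof -
    have "(a, c') \<in> Y"
      using * ac aligned_low [OF Y(2) ac *(2)] by (cases "c' = c") auto
    then show ?thesis
      using * aligned_high [OF Y(2) _ *(1), of a c'] by (cases "a' = a") auto
  qed
  then show "(a, c) \<in> down n lo X" using ac Y(3) by (auto simp: down_def)
qed

lemma down_aligned_eq:
  "biclosed n X \<Longrightarrow> aligned n lo X \<Longrightarrow> down n lo X = X"
  by (intro equalityI down_subset down_greatest) auto

section \<open>Intersections and joins of aligned sets\<close>

lemma aligned_Int_biclosed: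
  assumes X: "biclosed n X" "aligned n lo X" and Y: "biclosed n Y" "aligned n lo Y"
  shows "biclosed n (X \<inter> Y)" "aligned n lo (X \<inter> Y)"
proof -
  show al: "aligned n lo (X \<inter> Y)" 
    unfolding aligned_def
  proof (intro allI impI)
    fix a b c
    assume "(a, c) \<in> X \<inter> Y" and b: "b \<in> vals n" "a < b" "b < c"
    then have ac: "(a, c) \<in> X" "(a, c) \<in> Y" by auto
    show "if lo b then (a, b) \<in> X \<inter> Y else (b, c) \<in> X \<inter> Y"
      using aligned_low [OF X(2) ac(1) b] aligned_low [OF Y(2) ac(2) b]
        aligned_high [OF X(2) ac(1) b] aligned_high [OF Y(2) ac(2) b] by simp
  qed
  \<comment> \<open>The colour of \<open>b\<close> names the half that is inverted, and it names the
    same half in both sets.\<close>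
  have "(a, b) \<in> X \<inter> Y \<or> (b, c) \<in> X \<inter> Y" if "(a, c) \<in> X \<inter> Y" "b \<in> vals n" "a < b" "b < c" for a b c
    using aligned_low [OF al that] aligned_high [OF al that] by blast
  moreover have "(a, c) \<in> X \<inter> Y" if "(a, b) \<in> X \<inter> Y" "(b, c) \<in> X \<inter> Y" for a b c
    using that biclosed_trans [OF X(1)] biclosed_trans [OF Y(1)] by blast
  moreover have "(- c, - a) \<in> X \<inter> Y" if "(a, c) \<in> X \<inter> Y" for a c
    using that biclosed_sym [OF X(1)] biclosed_sym [OF Y(1)] by blast
  moreover have "X \<inter> Y \<subseteq> roots n"
    using biclosed_subset [OF X(1)] by blast
  ultimately show "biclosed n (X \<inter> Y)"
    by (intro biclosedI) metis+
qed

lemma aligned_jn: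
  assumes X: "biclosed n X" "aligned n lo X" and Y: "biclosed n Y" "aligned n lo Y"
  shows "aligned n lo (jn X Y)"
  unfolding aligned_def
proof (intro allI impI)
  fix a b c
  assume ac: "(a, c) \<in> jn X Y" and b: "b \<in> vals n" "a < b" "b < c"
  define R where "R = X \<union> Y"
  have cross: "if lo b then (a, b) \<in> R\<^sup>+ else (b, c) \<in> R\<^sup>+"
    if "(a, d) \<in> R\<^sup>*" "(d, e) \<in> R" "(e, c) \<in> R\<^sup>*" "d < b" "b < e" for d e
  proof -
    have "if lo b then (d, b) \<in> R else (b, e) \<in> R"
      using that b aligned_low [OF X(2), of d e b] aligned_low [OF Y(2), of d e b]
        aligned_high [OF X(2), of d e b] aligned_high [OF Y(2), of d e b] by (auto simp: R_def)
    then show ?thesis using that by (meson rtrancl_into_trancl1 rtrancl_into_trancl2)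
  qed
  have acR: "(a, c) \<in> R\<^sup>+" using ac by (simp add: jn_def R_def)
  have "if lo b then (a, b) \<in> R\<^sup>+ else (b, c) \<in> R\<^sup>+"
    using trancl_crossing [OF acR b(2,3)]
  proof (elim disjE exE conjE)
    assume "(a, b) \<in> R\<^sup>+" "(b, c) \<in> R\<^sup>+"
    then show ?thesis by simp
  qed (rule cross)
  then show "if lo b then (a, b) \<in> jn X Y else (b, c) \<in> jn X Y"
    unfolding jn_def R_def .
qed

text \<open>The complement of \<open>down n lo X\<close> has the same dually aligned part as the complement of \<open>X\<close>:
  among the derived pairs lying in \<open>X\<close>, one with the smallest gap cannot leave \<open>X\<close> under
  the derivations of \<^const>\<open>down\<close>.\<close>

lemma down_compl_down:
  assumes lo: "skew n lo" and X: "biclosed n X"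
  shows "down n (\<lambda>b. \<not> lo b) (roots n - down n lo X) = down n (\<lambda>b. \<not> lo b) (roots n - X)"
proof
  show "down n (\<lambda>b. \<not> lo b) (roots n - X) \<subseteq> down n (\<lambda>b. \<not> lo b) (roots n - down n lo X)"
    using down_subset by (intro down_mono) blast
  show "down n (\<lambda>b. \<not> lo b) (roots n - down n lo X) \<subseteq> down n (\<lambda>b. \<not> lo b) (roots n - X)"
  proof clarify
    fix a c
    assume ac: "(a, c) \<in> down n (\<lambda>b. \<not> lo b) (roots n - down n lo X)"
    then have acr: "(a, c) \<in> roots n" using down_subset by blast
    have main: "(a', c') \<notin> X" if "a' \<in> vals n" "c' \<in> vals n" "a \<le> a'" "a' < c'" "c' \<le> c"
        "a' = a \<or> lo a'" "c' = c \<or> \<not> lo c'" for a' c'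
      using that
    proof (induction "nat (c' - a')" arbitrary: a' c' rule: less_induct)
      case less
      show ?case
      proof
        assume inX: "(a', c') \<in> X"
        have "(a', c') \<in> roots n - down n lo X"
          by (rule downD [OF ac]) (use less.prems in auto)
        then obtain d e where de: "d \<in> vals n" "e \<in> vals n" "a' \<le> d" "d < e" "e \<le> c'"
          "d = a' \<or> \<not> lo d" "e = c' \<or> lo e" "(d, e) \<notin> X"
          using inX unfolding down_def by blast
        \<comment> \<open>If \<open>e\<close> differs from \<open>c'\<close> it is low, so
          \<open>(e, c')\<close> is again derived from \<open>(a, c)\<close> by the dual rules and
          has a smaller gap. It is outside \<open>X\<close> by induction, and splitting at
          \<open>e\<close> leaves only \<open>(a', e)\<close>. The left end is treated
          likewise.\<close>
        have "(a', e) \<in> X"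
        proof (cases "e = c'")
          case False
          then have "(e, c') \<notin> X"
            using less.prems de by (intro less.hyps) auto
          then show ?thesis using biclosed_split [OF X inX, of e] False de by auto
        qed (use inX in simp)
        then have "(d, e) \<in> X"
        proof (cases "d = a'")
          case False
          then have "(a', d) \<notin> X"
            using less.prems de by (intro less.hyps) auto
          then show ?thesis using biclosed_split [OF X \<open>(a', e) \<in> X\<close>, of d] False de by auto
        qed simp
        then show False using de by simp
      qed
    qed
    then show "(a, c) \<in> down n (\<lambda>b. \<not> lo b) (roots n - X)"
      using acr by (auto simp: down_def roots_def)
  qed
qed

text \<open>Complements turn the smallest dually aligned superset into an aligned part for the
  opposite colouring. \<open>down_compl_down\<close> then recovers either part from the
  other.\<close>

lemma down_eq_iff:
  assumes lo: "skew n lo" and X: "biclosed n X" and Y: "biclosed n Y"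
  shows "down n lo X = down n lo Y \<longleftrightarrow>
    down n (\<lambda>b. \<not> lo b) (roots n - X) = down n (\<lambda>b. \<not> lo b) (roots n - Y)"
proof
  assume "down n lo X = down n lo Y"
  then show "down n (\<lambda>b. \<not> lo b) (roots n - X) = down n (\<lambda>b. \<not> lo b) (roots n - Y)"
    using down_compl_down [OF lo X] down_compl_down [OF lo Y] by simp
next
  have lo': "skew n (\<lambda>b. \<not> lo b)" using lo by (auto simp: skew_def)
  have "roots n - (roots n - X) = X" "roots n - (roots n - Y) = Y"
    using biclosed_subset X Y by blast+
  moreover assume "down n (\<lambda>b. \<not> lo b) (roots n - X) = down n (\<lambda>b. \<not> lo b) (roots n - Y)"
  ultimately show "down n lo X = down n lo Y"
    using down_compl_down [OF lo' biclosed_compl [OF X]] down_compl_down [OF lo' biclosed_compl [OF Y]] by simp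
qed

lemma down_mt:
  assumes lo: "skew n lo" and X: "biclosed n X" and Y: "biclosed n Y"
  shows "down n lo (mt n X Y) = down n lo X \<inter> down n lo Y"
proof
  show "down n lo (mt n X Y) \<subseteq> down n lo X \<inter> down n lo Y"
    using mt_lower [OF X Y] down_mono by (metis Int_greatest)
  have *: "biclosed n (down n lo X \<inter> down n lo Y)" "aligned n lo (down n lo X \<inter> down n lo Y)"
    using aligned_Int_biclosed [OF down_biclosed [OF lo X] down_aligned [OF X] down_biclosed [OF lo Y] down_aligned [OF Y]]
    by auto
  have "down n lo X \<inter> down n lo Y \<subseteq> mt n X Y"
    by (rule mt_greatest [OF *(1)]) (use down_subset in blast)+
  then show "down n lo X \<inter> down n lo Y \<subseteq> down n lo (mt n X Y)"
    using down_greatest * by blast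
qed

section \<open>The congruence of equal aligned parts\<close>

definition down_cong :: "nat \<Rightarrow> (int \<Rightarrow> bool) \<Rightarrow> ((int \<Rightarrow> int) \<times> (int \<Rightarrow> int)) set" where
  "down_cong n lo = {(x, y). x \<in> Bn n \<and> y \<in> Bn n \<and> down n lo (invs n x) = down n lo (invs n y)}"

text \<open>The aligned part of a meet depends only on the aligned parts of its arguments. For joins
  the same is applied to complements with opposite colours, which describe the same classes by
  \<open>down_eq_iff\<close>.\<close>

lemma down_cong_lattice_cong:
  assumes lo: "skew n lo"
  shows "lattice_cong n (down_cong n lo)"
proof -
  let ?E = "roots n"
  have lo': "skew n (\<lambda>b. \<not> lo b)" using lo by (auto simp: skew_def)
  have eqv: "equiv (Bn n) (down_cong n lo)"
    by (auto simp: equiv_def refl_on_def sym_def trans_def down_cong_def)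
  have "(m1, m2) \<in> down_cong n lo"
    if "(x, y) \<in> down_cong n lo" "z \<in> Bn n" "is_meet n x z m1" "is_meet n y z m2" for x y z m1 m2
  proof -
    have "x \<in> Bn n" "y \<in> Bn n" and eq: "down n lo (invs n x) = down n lo (invs n y)"
      using that(1) by (auto simp: down_cong_def)
    then show ?thesis
      using that(2-) lo by (auto simp: down_cong_def is_meet_iff down_mt invs_biclosed)
  qed
  moreover have "(j1, j2) \<in> down_cong n lo"
    if "(x, y) \<in> down_cong n lo" "z \<in> Bn n" "is_join n x z j1" "is_join n y z j2" for x y z j1 j2
  proof -
    have B: "x \<in> Bn n" "y \<in> Bn n" and eq: "down n lo (invs n x) = down n lo (invs n y)"
      using that(1) by (auto simp: down_cong_def)
    have j: "j1 \<in> Bn n" "invs n j1 = jn (invs n x) (invs n z)" "j2 \<in> Bn n" "invs n j2 = jn (invs n y) (invs n z)"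
      using that B by (auto simp: is_join_iff)
    have b: "biclosed n (invs n x)" "biclosed n (invs n y)" "biclosed n (invs n z)"
      using B that(2) by (simp_all add: invs_biclosed)
    note c = b [THEN biclosed_compl]
    have "down n (\<lambda>b. \<not> lo b) (?E - invs n x) = down n (\<lambda>b. \<not> lo b) (?E - invs n y)"
      using eq down_eq_iff [OF lo b(1,2)] by blast
    then have "down n (\<lambda>b. \<not> lo b) (?E - invs n j1) = down n (\<lambda>b. \<not> lo b) (?E - invs n j2)"
      unfolding j compl_jn [OF b(1,3)] compl_jn [OF b(2,3)] down_mt [OF lo' c(1,3)] down_mt [OF lo' c(2,3)]
      by simp
    then have "down n lo (invs n j1) = down n lo (invs n j2)"
      using down_eq_iff [OF lo] j(1,3) invs_biclosed by blast
    then show ?thesis using j by (simp add: down_cong_def)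
  qed
  ultimately show ?thesis using eqv unfolding lattice_cong_def by blast
qed

section \<open>Generating pairs\<close>

text \<open>Neighbours among the nonzero values. The sets \<open>gen_lower b\<close> and \<open>gen_upper b\<close> are the inversion
  sets of the two members of the generating pair attached to the value \<open>b\<close>, with \<open>b > 0\<close> for
  the edge directed from \<open>s\<^bsub>b-1\<^esub>\<close> to \<open>s\<^bsub>b\<^esub>\<close> and \<open>b < 0\<close> for the opposite direction.\<close>

definition nxt :: "int \<Rightarrow> int" where "nxt b = (if b = - 1 then 1 else b + 1)"
definition prv :: "int \<Rightarrow> int" where "prv b = (if b = 1 then - 1 else b - 1)"

definition gen_lower :: "int \<Rightarrow> (int \<times> int) set" where
  "gen_lower b = {(b, nxt b), (- nxt b, - b)}"

definition gen_upper :: "int \<Rightarrow> (int \<times> int) set" where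
  "gen_upper b = gen_lower b \<union> {(prv b, nxt b), (- nxt b, - prv b)} \<union> (if \<bar>b\<bar> = 1 then {(- 2, 2)} else {})"

text \<open>The edge between \<open>s_(i-1)\<close> and \<open>s_i\<close> colours \<open>i\<close>
  and \<open>- i\<close>, and exactly one of them is low. For an orientation there is no edge at
  \<open>n\<close>, so \<open>n\<close> becomes high and \<open>- n\<close> low, which keeps the
  colouring antisymmetric.\<close>

definition low :: "(nat \<times> nat) set \<Rightarrow> int \<Rightarrow> bool" where
  "low D b = (if b > 0 then (nat b - 1, nat b) \<in> D else (nat (- b) - 1, nat (- b)) \<notin> D)"

lemma low_skew: "skew n (low D)"
  by (auto simp: skew_def low_def vals_def)

lemma kinv_id: "kinv n id = {}"
  by (auto simp: kinv_def roots_def)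

lemma invs_gen: "k < n \<Longrightarrow> invs n (gen k) = (if k = 0 then {(- 1, 1)} else {(int k, int k + 1), (- int k - 1, - int k)})"
  using invs_comp_gen [OF Bn_id, of k n] by (auto simp: kinv_id inv_id)

lemma gen_word_invs:
  assumes "1 \<le> i" "i < n"
  shows "invs n (gen i) = gen_lower (int i)"
    "invs n (word_prod (alt_word i (i - 1) (mcox (i - 1) i - 1))) = gen_upper (int i)"
    "invs n (gen (i - 1)) = gen_lower (- int i)"
    "invs n (word_prod (alt_word (i - 1) i (mcox i (i - 1) - 1))) = gen_upper (- int i)"
proof -
  show "invs n (gen i) = gen_lower (int i)" "invs n (gen (i - 1)) = gen_lower (- int i)"
    using assms by (auto simp: invs_gen gen_lower_def nxt_def)
  have B: "gen i \<in> Bn n" "gen (i - 1) \<in> Bn n" using assms by (simp_all add: gen_Bn)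
  have m: "mcox (i - 1) i = (if i = 1 then 4 else 3)" "mcox i (i - 1) = (if i = 1 then 4 else 3)"
    using assms by (auto simp: mcox_def doubleton_eq_iff)
  have m1: "mcox 0 1 = 4" "mcox 1 0 = 4"
    by (auto simp: mcox_def)
  have g: "gen 0 1 = - 1" "gen 0 (- 1) = 1" "gen 0 2 = 2" "gen 0 (- 2) = - 2" "gen 1 1 = 2" "gen 1 2 = 1" "gen 1 (- 1) = - 2"
    by (simp_all add: gen_def)
  \<comment> \<open>For \<open>i = 1\<close> the product of the two generators has order 4, so the
    words have three letters and also invert \<open>(- 2, 2)\<close>.\<close>
  have i1: "invs n (gen 1 \<circ> gen 0 \<circ> gen 1) = gen_upper 1" "invs n (gen 0 \<circ> gen 1 \<circ> gen 0) = gen_upper (- 1)"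
    if "i = 1"
  proof -
    have n: "0 < n" "1 < n" and B: "gen 0 \<in> Bn n" "gen 1 \<in> Bn n" using assms that by (auto intro: gen_Bn)
    have "invs n (gen 1 \<circ> gen 0) = invs n (gen 1) \<union> {(- 2, 2), (- 2, 2)}"
      using invs_comp_gen [OF B(2) n(1) refl refl] by (simp add: g insert_commute del: One_nat_def)
    moreover have "invs n (gen 1 \<circ> gen 0 \<circ> gen 1) = invs n (gen 1 \<circ> gen 0) \<union> {(- 1, 2), (- 2, 1)}"
      using invs_comp_gen [OF Bn_comp [OF B(2,1)] n(2) refl refl] by (simp add: g insert_commute del: One_nat_def)
    ultimately show "invs n (gen 1 \<circ> gen 0 \<circ> gen 1) = gen_upper 1"
      using n by (auto simp: invs_gen gen_upper_def gen_lower_def nxt_def prv_def)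
    have "invs n (gen 0 \<circ> gen 1) = invs n (gen 0) \<union> {(- 1, 2), (- 2, 1)}"
      using invs_comp_gen [OF B(1) n(2) refl refl] by (simp add: g insert_commute del: One_nat_def)
    moreover have "invs n (gen 0 \<circ> gen 1 \<circ> gen 0) = invs n (gen 0 \<circ> gen 1) \<union> {(- 2, 2), (- 2, 2)}"
      using invs_comp_gen [OF Bn_comp [OF B] n(1) refl refl] by (simp add: g insert_commute del: One_nat_def)
    ultimately show "invs n (gen 0 \<circ> gen 1 \<circ> gen 0) = gen_upper (- 1)"
      using n by (auto simp: invs_gen gen_upper_def gen_lower_def nxt_def prv_def)
  qed
  have i2: "invs n (gen i \<circ> gen (i - 1)) = gen_upper (int i)" "invs n (gen (i - 1) \<circ> gen i) = gen_upper (- int i)"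
    if "i \<noteq> 1"
  proof -
    have k: "i - 1 < n" "i - 1 \<noteq> 0" "i \<noteq> 0" "int (i - 1) = int i - 1" using assms that by auto
    have g: "gen i (int i) = int i + 1" "gen i (int i - 1) = int i - 1"
      "gen (i - 1) (int i) = int i - 1" "gen (i - 1) (int i + 1) = int i + 1"
      using k by (simp_all add: gen_def)
    have "invs n (gen i \<circ> gen (i - 1)) = invs n (gen i) \<union> {(int i - 1, int i + 1), (- int i - 1, 1 - int i)}"
      using invs_comp_gen [OF B(1) k(1) refl refl] k by (simp add: g del: One_nat_def)
    moreover have "invs n (gen i) = {(int i, int i + 1), (- int i - 1, - int i)}"
      using invs_gen [OF assms(2)] k by simp
    moreover have "gen_upper (int i) = {(int i, int i + 1), (- int i - 1, - int i),
        (int i - 1, int i + 1), (- int i - 1, 1 - int i)}"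
    proof -
      have "int i \<noteq> 1" "\<bar>int i\<bar> \<noteq> 1" using that by auto
      then show ?thesis
        using assms(1) unfolding gen_upper_def gen_lower_def nxt_def prv_def by auto
    qed
    ultimately show "invs n (gen i \<circ> gen (i - 1)) = gen_upper (int i)"
      by auto
    have "invs n (gen (i - 1) \<circ> gen i) = invs n (gen (i - 1)) \<union> {(int i - 1, int i + 1), (- int i - 1, 1 - int i)}"
      using invs_comp_gen [OF B(2) assms(2) refl refl] k by (simp add: g del: One_nat_def)
    moreover have "invs n (gen (i - 1)) = {(int i - 1, int i), (- int i, 1 - int i)}"
      using invs_gen [OF k(1)] k by (simp del: One_nat_def)
    moreover have "gen_upper (- int i) = {(- int i, 1 - int i), (int i - 1, int i),
        (- int i - 1, 1 - int i), (int i - 1, int i + 1)}"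
    proof -
      have "int i \<noteq> 1" "\<bar>int i\<bar> \<noteq> 1" using that by auto
      then show ?thesis
        using assms(1) unfolding gen_upper_def gen_lower_def nxt_def prv_def by auto
    qed
    ultimately show "invs n (gen (i - 1) \<circ> gen i) = gen_upper (- int i)"
      by auto
  qed
  have w: "alt_word t s 2 = [t, s]" "alt_word t s 3 = [t, s, t]" for t s
    by (simp_all add: alt_word_def upt_rec)
  show "invs n (word_prod (alt_word i (i - 1) (mcox (i - 1) i - 1))) = gen_upper (int i)"
    using i1(1) i2(1) by (cases "i = 1") (simp_all add: m m1 w comp_assoc del: One_nat_def)
  show "invs n (word_prod (alt_word (i - 1) i (mcox i (i - 1) - 1))) = gen_upper (- int i)"
    using i1(2) i2(2) by (cases "i = 1") (simp_all add: m m1 w comp_assoc del: One_nat_def)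
qed


section \<open>Contracted cover relations\<close>

text \<open>Orders values by level, ties being broken by the values themselves, which are at most \<open>n\<close>
  in absolute value.\<close>

definition lift :: "nat \<Rightarrow> (int \<Rightarrow> int) \<Rightarrow> int \<Rightarrow> int" where
  "lift n lev x = (2 * int n + 1) * lev x + x"

lemma lift_less_iff:
  assumes "x \<in> vals n" "y \<in> vals n"
  shows "lift n lev x < lift n lev y \<longleftrightarrow> lev x < lev y \<or> (lev x = lev y \<and> x < y)"
proof -
  have *: "lift n lev x < lift n lev y" if "lev x < lev y" "x \<in> vals n" "y \<in> vals n" for x y
  proof -
    have "(2 * int n + 1) * 1 \<le> (2 * int n + 1) * (lev y - lev x)"
      using that(1) by (intro mult_left_mono) auto
    then have "2 * int n + 1 + (2 * int n + 1) * lev x \<le> (2 * int n + 1) * lev y"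
      by (simp add: right_diff_distrib)
    then show ?thesis using that(2,3) unfolding lift_def vals_def by auto
  qed
  consider "lev x < lev y" | "lev y < lev x" | "lev x = lev y" by linarith
  then show ?thesis
    using *[of x y] *[of y x] assms by cases (auto simp: lift_def)
qed

lemma lift_odd_key:
  assumes "\<And>x. x \<in> vals n \<Longrightarrow> lev (- x) = - lev x"
  shows "odd_key n (lift n lev)"
proof -
  have "x = y" if "lift n lev x = lift n lev y" "x \<in> vals n" "y \<in> vals n" for x y
    using lift_less_iff [of x n y lev] lift_less_iff [of y n x lev] that by (metis less_irrefl linorder_neqE)
  moreover have "lift n lev (- x) = - lift n lev x" if "x \<in> vals n" for x
    unfolding lift_def assms [OF that] by simp
  ultimately show ?thesis by (simp add: odd_key_def inj_on_def)
qed

definition adjacent :: "nat \<Rightarrow> (int \<Rightarrow> int) \<Rightarrow> int \<Rightarrow> int \<Rightarrow> bool" where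
  "adjacent n k a c \<longleftrightarrow> k a < k c \<and> (\<forall>d \<in> vals n. \<not> (k a < k d \<and> k d < k c))"

lemma adjacent_uminus:
  assumes k: "odd_key n k" and "a \<in> vals n" "c \<in> vals n"
  shows "adjacent n k (- c) (- a) \<longleftrightarrow> adjacent n k a c"
proof -
  have "(\<forall>d \<in> vals n. \<not> (- k c < k d \<and> k d < - k a)) \<longleftrightarrow> (\<forall>d \<in> vals n. \<not> (k a < k d \<and> k d < k c))"
  proof (intro iffI ballI)
    fix d
    assume "\<forall>d \<in> vals n. \<not> (- k c < k d \<and> k d < - k a)" "d \<in> vals n"
    then show "\<not> (k a < k d \<and> k d < k c)"
      using odd_key_uminus [OF k, of d] by (auto dest: bspec [of _ _ "- d"])
  next
    fix d
    assume "\<forall>d \<in> vals n. \<not> (k a < k d \<and> k d < k c)" "d \<in> vals n"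
    then show "\<not> (- k c < k d \<and> k d < - k a)"
      using odd_key_uminus [OF k, of d] by (auto dest: bspec [of _ _ "- d"])
  qed
  then show ?thesis
    using odd_key_uminus [OF k] assms by (simp add: adjacent_def)
qed

lemma kinv_swap_adjacent:
  assumes "odd_key n k" "(a, c) \<in> roots n" "adjacent n k a c"
  shows "kinv n (k \<circ> tr a c) = kinv n k \<union> {(a, c), (- c, - a)}"
    and "(a, c) \<notin> kinv n k" "(- c, - a) \<notin> kinv n k"
  using kinv_swap [OF assms(1,2)] assms biclosed_sym [OF kinv_biclosed [OF assms(1)], of c a]
  by (auto simp: adjacent_def kinv_iff)

text \<open>What the contraction argument uses of \<open>Theta\<close>, transported to inversion
  sets: stability under join and meet with a fixed set, and one contracted pair for every low
  value.\<close>

locale set_cong =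
  fixes n :: nat and lo :: "int \<Rightarrow> bool" and R :: "(int \<times> int) set \<Rightarrow> (int \<times> int) set \<Rightarrow> bool"
  assumes skew: "skew n lo"
    and R_biclosed: "R X Y \<Longrightarrow> biclosed n X \<and> biclosed n Y"
    and R_sym: "R X Y \<Longrightarrow> R Y X"
    and R_jn: "R X Y \<Longrightarrow> biclosed n Z \<Longrightarrow> R (jn X Z) (jn Y Z)"
    and R_mt: "R X Y \<Longrightarrow> biclosed n Z \<Longrightarrow> R (mt n X Z) (mt n Y Z)"
    and R_gen: "b \<in> vals n \<Longrightarrow> \<bar>b\<bar> < int n \<Longrightarrow> lo b \<Longrightarrow> R (gen_lower b) (gen_upper b)"
begin

text \<open>\<open>Y\<close> is covered by \<open>X\<close> with label \<open>(a, c)\<close>. From \<open>R U V\<close> follows \<open>R Q (jn Q V)\<close>; meeting with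
  \<open>X\<close> and joining with \<open>Y\<close> turns this pair into \<open>Y\<close> and \<open>X\<close>.\<close>

lemma contract_via_join:
  assumes UV: "R U V" and Q: "biclosed n Q" "U \<subseteq> Q" "(a, c) \<notin> Q"
    and X: "biclosed n X" and Y: "biclosed n Y" and XY: "X = Y \<union> {(a, c), (- c, - a)}"
    and gen: "\<And>f d. f < d \<Longrightarrow> a \<le> f \<Longrightarrow> d \<le> c \<Longrightarrow> (f, c) \<in> X \<Longrightarrow> (a, d) \<in> X \<Longrightarrow> (f, d) \<in> jn Q V"
  shows "R X Y"
proof -
  define T where "T = jn Q V"
  have V: "biclosed n V" using R_biclosed [OF UV] by simp
  have T: "biclosed n T" unfolding T_def by (rule jn_biclosed [OF Q(1) V])
  have jQ: "jn U Q = Q"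
    by (intro equalityI jn_least [OF Q(1,2)] order_refl jn_upper2)
  have "R (jn U Q) (jn V Q)" by (rule R_jn [OF UV Q(1)])
  then have "R Q T" unfolding jQ T_def by (simp add: jn_def Un_commute)
  then have step: "R (jn (mt n Q X) Y) (jn (mt n T X) Y)"
    by (intro R_jn R_mt X Y)
  have acX: "(a, c) \<in> X" using XY by simp
  have ac: "a \<in> vals n" "c \<in> vals n" "a < c" using biclosed_roots [OF X acX] by auto
  have "mt n Q X \<subseteq> Y"
    using mt_lower [OF Q(1) X] Q(3) biclosed_sym [OF Q(1), of c a] XY by auto
  then have lower: "jn (mt n Q X) Y = Y"
    by (intro equalityI jn_least [OF Y] order_refl jn_upper2)
  define N where "N = (roots n - T) \<union> (roots n - X)"
  \<comment> \<open>The complement of \<open>mt n T X\<close> is the closure of \<open>N\<close>, so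
    no chain in \<open>N\<close> may lead from \<open>a\<close> to \<open>c\<close>. As long as it
    has not passed \<open>c\<close>, \<open>(d, c)\<close> stays in \<open>X\<close>, which prevents
    the next step from ending at \<open>c\<close>.\<close>
  have chain: "d \<le> c \<longrightarrow> d < c \<and> a < d \<and> (d, c) \<in> X" if "(a, d) \<in> N\<^sup>+" for d
    using that
  proof (induction rule: trancl_induct)
    case (base d)
    show ?case
    proof
      assume dc: "d \<le> c"
      have d: "d \<in> vals n" "a < d" using base by (auto simp: N_def roots_def)
      have "(a, d) \<notin> X"
        using base gen [OF d(2) order_refl dc acX] by (auto simp: N_def T_def)
      then show "d < c \<and> a < d \<and> (d, c) \<in> X"
        using acX dc d biclosed_split [OF X acX d(1,2)] by (cases "d = c") auto
    qed
  next
    case (step d e)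
    show ?case
    proof
      assume ec: "e \<le> c"
      have e: "e \<in> vals n" "d < e" using step.hyps(2) by (auto simp: N_def roots_def)
      then have d: "d < c" "a < d" "(d, c) \<in> X" using step.IH ec by auto
      have "(d, e) \<notin> X \<or> (a, e) \<notin> X"
        using step.hyps(2) gen [OF e(2) _ ec d(3)] d by (auto simp: N_def T_def)
      then show "e < c \<and> a < e \<and> (e, c) \<in> X"
        using acX d ec e biclosed_split [OF X acX e(1)] biclosed_split [OF X d(3) e]
        by (cases "e = c") auto
    qed
  qed
  have "(a, c) \<in> mt n T X"
    using chain [of c] ac by (auto simp: mt_def jn_def N_def roots_def)
  then have "(a, c) \<in> jn (mt n T X) Y" using jn_upper1 by blast
  moreover have "(- c, - a) \<in> jn (mt n T X) Y"
    using calculation biclosed_sym [OF jn_biclosed [OF mt_biclosed [OF T X] Y]] by simp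
  ultimately have "X \<subseteq> jn (mt n T X) Y"
    using XY jn_upper2 [of Y] by auto
  then have "jn (mt n T X) Y = X"
    using jn_least [OF X mt_lower(2) [OF T X], of Y] XY by blast
  then show ?thesis using R_sym [OF step] lower by simp
qed

text \<open>The labels from which the induction on \<open>c - a\<close> cannot descend.\<close>

lemma contract_minimal:
  assumes X: "biclosed n X" and Y: "biclosed n Y" and XY: "X = Y \<union> {(a, c), (- c, - a)}"
    and b: "lo b" "b \<in> vals n" "a < b" "b < c" "(a, b) \<notin> X"
    and cases: "(a = prv b \<and> c = nxt b) \<or> (a = - 2 \<and> c = 2 \<and> \<bar>b\<bar> = 1) \<or>
      (a, b, c) \<in> {(- 1, 2, 3), (- 3, - 2, 1), (- 2, 1, 3), (- 3, 1, 2)} \<or>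
      ((a, b, c) \<in> {(- 2, - 1, 3), (- 3, - 1, 2)} \<and> (- b, c) \<notin> X)"
  shows "R X Y"
proof -
  have acX: "(a, c) \<in> X" using XY by simp
  then have ac: "a \<in> vals n" "c \<in> vals n" using biclosed_roots [OF X] by auto
  have "\<bar>b\<bar> < int n" using b ac by (auto simp: vals_def)
  then have UV: "R (gen_lower b) (gen_upper b)" using R_gen b by blast
  have UB: "biclosed n (gen_lower b)" using R_biclosed [OF UV] by simp
  have jn1: "(f, d) \<in> A \<Longrightarrow> (f, d) \<in> jn A B" "(f, d) \<in> B \<Longrightarrow> (f, d) \<in> jn A B" for f d A B
    using jn_upper1 jn_upper2 by blast+
  have jnI: "(f, d) \<in> A \<union> B \<Longrightarrow> (f, d) \<in> jn A B" for f d A B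
    using jn1 by blast
  have ne: "f \<noteq> c" "f \<noteq> 0" "d \<noteq> 0" "d \<noteq> b" "d \<noteq> a" if "(f, c) \<in> X" "(a, d) \<in> X" for f d
    using that b biclosed_roots [OF X that(1)] biclosed_roots [OF X that(2)] by (auto simp: vals_def)
  note gu = gen_upper_def gen_lower_def nxt_def prv_def
  show ?thesis
    using cases
  proof (elim disjE)
    assume c: "a = prv b \<and> c = nxt b"
    show ?thesis
    proof (rule contract_via_join [OF UV UB order_refl _ X Y XY])
      show "(a, c) \<notin> gen_lower b" using c b vals_nz [OF b(2)] by (auto simp: gu)
      fix f d
      assume fd: "f < d" "a \<le> f" "d \<le> c" "(f, c) \<in> X" "(a, d) \<in> X"
      then have "f = a \<or> f = b" "d = c"
        using ne [OF fd(4,5)] c vals_nz [OF b(2)] by (auto simp: nxt_def prv_def split: if_splits)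
      then show "(f, d) \<in> jn (gen_lower b) (gen_upper b)"
        using c by (intro jn1(2)) (auto simp: gu)
    qed
  next
    assume c: "a = - 2 \<and> c = 2 \<and> \<bar>b\<bar> = 1"
    show ?thesis
    proof (rule contract_via_join [OF UV UB order_refl _ X Y XY])
      show "(a, c) \<notin> gen_lower b" using c b by (auto simp: gu)
      fix f d
      assume fd: "f < d" "a \<le> f" "d \<le> c" "(f, c) \<in> X" "(a, d) \<in> X"
      \<comment> \<open>The mirror image of \<open>(- b, c)\<close> is \<open>(a, b)\<close>, which
        is not inverted.\<close>
      have "f \<noteq> - b" using fd(4) b(5) biclosed_sym [OF X, of b a] c by auto
      then have "f \<in> {- 2, b}" "d \<in> {- b, 2}"
        using ne [OF fd(4,5)] fd c by (auto simp: abs_if split: if_splits)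
      then show "(f, d) \<in> jn (gen_lower b) (gen_upper b)"
        using c fd(1) by (intro jn1(2)) (auto simp: gu abs_if split: if_splits)
    qed
  next
    assume "(a, b, c) \<in> {(- 1, 2, 3), (- 3, - 2, 1), (- 2, 1, 3), (- 3, 1, 2)}"
    then consider (1) "a = - 1" "b = 2" "c = 3" | (2) "a = - 3" "b = - 2" "c = 1"
      | (3) "a = - 2" "b = 1" "c = 3" | (4) "a = - 3" "b = 1" "c = 2" by auto
    \<comment> \<open>In these labels \<open>gen_upper b\<close> does not contain
      \<open>(a, c)\<close>, so \<open>Q = gen_lower b\<close> is too small. Each \<open>Q\<close>
      below is the inversion set of a permutation that contains \<open>gen_lower b\<close>, avoids
      \<open>(a, c)\<close> and supplies the links missing from the chains.\<close>
    then show ?thesis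
    proof cases
      case 1
      have v: "1 \<in> vals n" "2 \<in> vals n" "3 \<in> vals n" using 1 ac by (auto simp: vals_def)
      have Qk: "odd_key n (tr 1 (- 1) \<circ> tr 2 3)" using v by (intro Bn_odd_key Bn_comp tr_Bn) auto
      show ?thesis
      proof (rule contract_via_join [OF UV kinv_biclosed [OF Qk] _ _ X Y XY])
        show "gen_lower b \<subseteq> kinv n (tr 1 (- 1) \<circ> tr 2 3)" "(a, c) \<notin> kinv n (tr 1 (- 1) \<circ> tr 2 3)"
          using v 1 by (auto simp: kinv_iff gu tr_def)
        fix f d
        assume fd: "f < d" "a \<le> f" "d \<le> c" "(f, c) \<in> X" "(a, d) \<in> X"
        let ?J = "jn (kinv n (tr 1 (- 1) \<circ> tr 2 3)) (gen_upper b)"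
        have J: "(- 1, 1) \<in> ?J" "(2, 3) \<in> ?J" "(1, 3) \<in> ?J"
          using v 1 by (auto intro!: jnI simp: kinv_iff gu tr_def)
        have J2: "(- 1, 3) \<in> ?J" using jn_trans J by blast
        have "f \<in> {- 1, 1, 2}" "d \<in> {1, 3}" using ne [OF fd(4,5)] fd 1 by auto
        then show "(f, d) \<in> ?J" using fd(1) J J2 by auto
      qed
    next
      case 2
      have v: "1 \<in> vals n" "2 \<in> vals n" "3 \<in> vals n" using 2 ac by (auto simp: vals_def)
      have Qk: "odd_key n (tr 1 (- 1) \<circ> tr 2 (- 2))" using v by (intro Bn_odd_key Bn_comp tr_Bn) auto
      show ?thesis
      proof (rule contract_via_join [OF UV kinv_biclosed [OF Qk] _ _ X Y XY])
        show "gen_lower b \<subseteq> kinv n (tr 1 (- 1) \<circ> tr 2 (- 2))" "(a, c) \<notin> kinv n (tr 1 (- 1) \<circ> tr 2 (- 2))"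
          using v 2 by (auto simp: kinv_iff gu tr_def)
        fix f d
        assume fd: "f < d" "a \<le> f" "d \<le> c" "(f, c) \<in> X" "(a, d) \<in> X"
        let ?J = "jn (kinv n (tr 1 (- 1) \<circ> tr 2 (- 2))) (gen_upper b)"
        have J: "(- 3, - 1) \<in> ?J" "(- 2, - 1) \<in> ?J" "(- 2, 1) \<in> ?J" "(- 1, 1) \<in> ?J"
          using v 2 by (auto intro!: jnI simp: kinv_iff gu tr_def)
        have J2: "(- 3, 1) \<in> ?J" using jn_trans J by blast
        have "f \<in> {- 3, - 2, - 1}" "d \<in> {- 1, 1}" using ne [OF fd(4,5)] fd 2 by auto
        then show "(f, d) \<in> ?J" using fd(1) J J2 by auto
      qed
    next
      case 3
      have v: "1 \<in> vals n" "2 \<in> vals n" "3 \<in> vals n" using 3 ac by (auto simp: vals_def)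
      have Qk: "odd_key n (tr 1 3)" using v by (intro Bn_odd_key tr_Bn) auto
      show ?thesis
      proof (rule contract_via_join [OF UV kinv_biclosed [OF Qk] _ _ X Y XY])
        show "gen_lower b \<subseteq> kinv n (tr 1 3)" "(a, c) \<notin> kinv n (tr 1 3)"
          using v 3 by (auto simp: kinv_iff gu tr_def)
        fix f d
        assume fd: "f < d" "a \<le> f" "d \<le> c" "(f, c) \<in> X" "(a, d) \<in> X"
        let ?J = "jn (kinv n (tr 1 3)) (gen_upper b)"
        have J: "(- 2, - 1) \<in> ?J" "(- 2, 2) \<in> ?J" "(- 1, 2) \<in> ?J" "(1, 2) \<in> ?J" "(1, 3) \<in> ?J" "(2, 3) \<in> ?J"
          using v 3 by (auto intro!: jnI simp: kinv_iff gu tr_def)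
        have J2: "(- 2, 3) \<in> ?J" "(- 1, 3) \<in> ?J" using jn_trans J by blast+
        have "f \<in> {- 2, - 1, 1, 2}" "d \<in> {- 1, 2, 3}" using ne [OF fd(4,5)] fd 3 by auto
        then show "(f, d) \<in> ?J" using fd(1) J J2 by auto
      qed
    next
      case 4
      have v: "1 \<in> vals n" "2 \<in> vals n" "3 \<in> vals n" using 4 ac by (auto simp: vals_def)
      have Qk: "odd_key n (tr 1 3)" using v by (intro Bn_odd_key tr_Bn) auto
      show ?thesis
      proof (rule contract_via_join [OF UV kinv_biclosed [OF Qk] _ _ X Y XY])
        show "gen_lower b \<subseteq> kinv n (tr 1 3)" "(a, c) \<notin> kinv n (tr 1 3)"
          using v 4 by (auto simp: kinv_iff gu tr_def)
        fix f d
        assume fd: "f < d" "a \<le> f" "d \<le> c" "(f, c) \<in> X" "(a, d) \<in> X"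
        let ?J = "jn (kinv n (tr 1 3)) (gen_upper b)"
        have J: "(- 3, - 2) \<in> ?J" "(- 3, - 1) \<in> ?J" "(- 2, - 1) \<in> ?J" "(- 2, 2) \<in> ?J" "(- 1, 2) \<in> ?J" "(1, 2) \<in> ?J"
          using v 4 by (auto intro!: jnI simp: kinv_iff gu tr_def)
        have J2: "(- 3, 2) \<in> ?J" using jn_trans J by blast+
        have "f \<in> {- 3, - 2, - 1, 1}" "d \<in> {- 2, - 1, 2}" using ne [OF fd(4,5)] fd 4 by auto
        then show "(f, d) \<in> ?J" using fd(1) J J2 by auto
      qed
    qed
  next
    assume "(a, b, c) \<in> {(- 2, - 1, 3), (- 3, - 1, 2)} \<and> (- b, c) \<notin> X"
    then have b1: "b = - 1" "(1, c) \<notin> X" and "(a = - 2 \<and> c = 3) \<or> (a = - 3 \<and> c = 2)" by auto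
    then have v: "1 \<in> vals n" "2 \<in> vals n" "3 \<in> vals n" using ac by (auto simp: vals_def)
    have Qk: "odd_key n (tr 1 (- 1) \<circ> tr 2 3)" using v by (intro Bn_odd_key Bn_comp tr_Bn) auto
    let ?J = "jn (kinv n (tr 1 (- 1) \<circ> tr 2 3)) (gen_upper b)"
    have J: "(- 3, - 2) \<in> ?J" "(- 2, 1) \<in> ?J" "(- 2, 2) \<in> ?J" "(- 1, 1) \<in> ?J" "(- 1, 2) \<in> ?J" "(2, 3) \<in> ?J"
      using v b1 by (auto intro!: jnI simp: kinv_iff gu tr_def)
    have J2: "(- 2, 3) \<in> ?J" "(- 1, 3) \<in> ?J" "(- 3, 1) \<in> ?J" "(- 3, 2) \<in> ?J"
      using jn_trans [OF J(3) J(6)] jn_trans [OF J(5) J(6)] jn_trans [OF J(1) J(2)] jn_trans [OF J(1) J(3)] .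
    show ?thesis
    proof (rule contract_via_join [OF UV kinv_biclosed [OF Qk] _ _ X Y XY])
      show "gen_lower b \<subseteq> kinv n (tr 1 (- 1) \<circ> tr 2 3)"
        using v b1 by (auto simp: kinv_iff gu tr_def)
      show "(a, c) \<notin> kinv n (tr 1 (- 1) \<circ> tr 2 3)"
        using \<open>(a = - 2 \<and> c = 3) \<or> (a = - 3 \<and> c = 2)\<close>
        by (elim disjE conjE) (simp_all add: kinv_iff tr_def)
      fix f d
      assume fd: "f < d" "a \<le> f" "d \<le> c" "(f, c) \<in> X" "(a, d) \<in> X"
      \<comment> \<open>No pair of \<open>?J\<close> starts at 1. This is why these two labels come
        with the extra condition on \<open>(- b, c)\<close>.\<close>
      have f1: "f \<noteq> 1" using fd(4) b1(2) by auto
      show "(f, d) \<in> ?J"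
        using \<open>(a = - 2 \<and> c = 3) \<or> (a = - 3 \<and> c = 2)\<close>
      proof
        assume a: "a = - 2 \<and> c = 3"
        have "f \<in> {- 2, - 1, 2}" "d \<in> {1, 2, 3}" using ne [OF fd(4,5)] fd(1-3) f1 a b1(1) by auto
        then show "(f, d) \<in> ?J" using fd(1) J J2 by auto
      next
        assume a: "a = - 3 \<and> c = 2"
        have "f \<in> {- 3, - 2, - 1}" "d \<in> {- 2, 1, 2}" using ne [OF fd(4,5)] fd(1-3) f1 a b1(1) by auto
        then show "(f, d) \<in> ?J" using fd(1) J J2 by auto
      qed
    qed
  qed
qed

text \<open>Some permutation with the same relevant inversions has \<open>a, e, c\<close> in consecutive positions.
  In the hexagon permuting them the cover labelled \<open>(a, c)\<close> is a side, so it is contracted as soon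
  as one of the two bottom covers, labelled \<open>(a, e)\<close> and \<open>(e, c)\<close>, is. Of these, use the one whose
  label contains \<open>b\<close>.\<close>

lemma hexagon:
  assumes p: "odd_key n p" and ac: "(a, c) \<in> roots n" "adjacent n p c a" "0 < p c"
    and b: "b \<in> vals n" "a < b" "b < c" "if lo b then p a < p b else p b < p c"
    and e: "e \<in> vals n" "a < e" "e < c" "e \<noteq> b" "e \<noteq> - a" "e \<noteq> - c" "\<not> (a < - e \<and> - e < c \<and> p a < p (- e))"
    and IH: "\<And>k a' c'. odd_key n k \<Longrightarrow> (a', c') \<in> roots n \<Longrightarrow> c' - a' < c - a \<Longrightarrow> adjacent n k a' c' \<Longrightarrow>
      a' < b \<Longrightarrow> b < c' \<Longrightarrow> (if lo b then k a' < k b else k b < k c') \<Longrightarrow> R (kinv n k) (kinv n (k \<circ> tr a' c'))"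
    and Y: "biclosed n Y" and XY: "kinv n p = Y \<union> {(a, c), (- c, - a)}"
  shows "R (kinv n p) Y"
proof -
  have v: "a \<in> vals n" "c \<in> vals n" "a < c" using ac by (auto simp: roots_def)
  have pa: "p c < p a" "\<And>d. d \<in> vals n \<Longrightarrow> \<not> (p c < p d \<and> p d < p a)" using ac(2) by (auto simp: adjacent_def)
  have neg: "p (- x) = - p x" if "x \<in> vals n" for x using odd_key_uminus [OF p that] .
  have "a \<noteq> - c" using neg [of c] v ac(3) pa(1) by auto
  define A where "A = {d \<in> vals n. a < d \<and> d < c \<and> p a < p d}"
  have A_neg: "- d \<notin> A" if "d \<in> A" for d using that neg ac(3) pa(1) by (auto simp: A_def)
  have nA: "a \<notin> A" "c \<notin> A" "- a \<notin> A" "- c \<notin> A" "- e \<notin> A"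
    using v neg ac(3) pa(1) e by (auto simp: A_def)
  have dist: "a \<noteq> e" "e \<noteq> c" "a \<noteq> c" "- a \<noteq> e" "- a \<noteq> c" "- c \<noteq> a" "- c \<noteq> e" "- e \<noteq> a" "- e \<noteq> c"
      "- a \<noteq> a" "- c \<noteq> c" "- e \<noteq> e"
    using \<open>a \<noteq> - c\<close> e v vals_nz [OF v(1)] vals_nz [OF v(2)] vals_nz [OF e(1)] by auto
  define pl :: "int \<Rightarrow> int"
    where "pl d = (if d = a then 1 else if d = e then 2 else if d = c then 3 else if d \<in> A then 4 else 0)" for d
  define lev where "lev d = pl d - pl (- d)" for d
  define k where "k = lift n lev"
  have k: "odd_key n k" unfolding k_def by (rule lift_odd_key) (simp add: lev_def)
  have kless: "k x < k y \<longleftrightarrow> lev x < lev y \<or> (lev x = lev y \<and> x < y)" if "x \<in> vals n" "y \<in> vals n" for x y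
    unfolding k_def using that by (rule lift_less_iff)
  have lev: "lev a = 1" "lev e = 2" "lev c = 3"
    using dist nA by (auto simp: lev_def pl_def)
  have levA: "lev d = 4" if "d \<in> A" "d \<noteq> e" for d
    using that A_neg [of d] nA dist by (auto simp: lev_def pl_def)
  have lev0: "lev d \<le> 0" if "d \<notin> A" "d \<notin> {a, e, c}" for d
    using that by (auto simp: lev_def pl_def)
  have lev_cases: "d = a \<or> d = e \<or> d = c \<or> (d \<in> A \<and> lev d = 4) \<or> lev d \<le> 0" for d
    using levA [of d] lev0 [of d] by blast
  have adj1: "adjacent n k a e"
    unfolding adjacent_def
  proof (intro conjI ballI notI)
    show "k a < k e" using v e by (simp add: kless lev)
    fix d assume "d \<in> vals n" "k a < k d \<and> k d < k e"
    then show False using lev_cases [of d] v e by (auto simp: kless lev)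
  qed
  have adj2: "adjacent n k e c"
    unfolding adjacent_def
  proof (intro conjI ballI notI)
    show "k e < k c" using v e by (simp add: kless lev)
    fix d assume "d \<in> vals n" "k e < k d \<and> k d < k c"
    then show False using lev_cases [of d] v e by (auto simp: kless lev)
  qed
  define U V1 V2 where "U = kinv n k" and "V1 = kinv n (k \<circ> tr a e)" and "V2 = kinv n (k \<circ> tr e c)"
  have r: "(a, e) \<in> roots n" "(e, c) \<in> roots n" using v e by (auto simp: roots_def)
  note V1 = kinv_swap_adjacent(1) [OF k r(1) adj1, folded U_def V1_def]
  note V2 = kinv_swap_adjacent(1) [OF k r(2) adj2, folded U_def V2_def]
  have B: "biclosed n V1" "biclosed n V2"
    unfolding V1_def V2_def using k v e by (auto intro!: kinv_biclosed odd_key_tr)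
  have acU: "(a, c) \<notin> U" using v by (auto simp: U_def kinv_iff kless lev)
  have ac1: "(a, c) \<notin> V1" "(a, c) \<notin> V2"
    using acU dist by (auto simp: V1 V2)
  \<comment> \<open>Since \<open>a\<close> and \<open>c\<close> are neighbours in \<open>p\<close>,
    \<open>f\<close> is \<open>a\<close> or in \<open>A\<close>, and \<open>d\<close> is not in
    \<open>A\<close>. Such pairs are already inverted in \<open>U\<close>, except those formed by
    \<open>a\<close>, \<open>e\<close>, \<open>c\<close>, which the two bottom covers
    generate.\<close>
  have cover: "(f, d) \<in> jn V1 V2"
    if fd: "f < d" "a \<le> f" "d \<le> c" "(f, c) \<in> kinv n p" "(a, d) \<in> kinv n p" for f d
  proof -
    have fdv: "f \<in> vals n" "d \<in> vals n" "f < c" "a < d" "p c < p f" "p d < p a"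
      using fd by (auto simp: kinv_iff)
    have f: "f = a \<or> f \<in> A"
      using fd(2) fdv pa(2) [of f] odd_key_eq_iff [OF p, of f a] v by (force simp: A_def)
    have d: "d \<notin> A" using fdv by (auto simp: A_def)
    have U: "(x, y) \<in> jn V1 V2" if "(x, y) \<in> U" for x y
      using that V1 jn_upper1 [of V1 V2] by blast
    have ae: "(a, e) \<in> jn V1 V2" and ec: "(e, c) \<in> jn V1 V2"
      using V1 V2 jn_upper1 [of V1 V2] jn_upper2 [of V2 V1] by blast+
    have ac: "(a, c) \<in> jn V1 V2" using jn_trans ae ec .
    consider "f = a" "d = c" | "f = a" "d = e" | "f = e" "d = c" | "f = a" "d \<noteq> c" "d \<noteq> e"
      | "f \<in> A" "f \<noteq> e" | "f \<in> A" "f = e" "d \<noteq> c" using f by blast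
    then show ?thesis
    proof cases
      case 4
      then have "(f, d) \<in> U" using fd(1) fdv lev0 [of d] d v by (auto simp: U_def kinv_iff kless lev)
      then show ?thesis by (rule U)
    next
      case 5
      then have "(f, d) \<in> U"
        using fd(1) fdv lev_cases [of d] levA [of f] d v e by (auto simp: U_def kinv_iff kless lev)
      then show ?thesis by (rule U)
    next
      case 6
      then have "(f, d) \<in> U"
        using fd(1) fdv lev_cases [of d] d v e by (auto simp: U_def kinv_iff kless lev)
      then show ?thesis by (rule U)
    qed (use ae ec ac in auto)
  qed
  have kb: "if lo b then 4 \<le> lev b else lev b \<le> 0"
    using b e lev0 [of b] levA [of b] v pa by (auto simp: A_def)
  \<comment> \<open>As \<open>b\<close> differs from \<open>e\<close>, exactly one bottom label
    contains it. That cover is contracted by induction, and the upper end of the other serves as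
    \<open>Q\<close>.\<close>
  show ?thesis
  proof (cases "b < e")
    case True
    have "R (kinv n k) (kinv n (k \<circ> tr a e))"
      by (rule IH [OF k r(1) _ adj1]) (use True e b kb v in \<open>auto simp: kless lev split: if_splits\<close>)
    then have "R U V1" by (simp add: U_def V1_def)
    then show ?thesis
    proof (rule contract_via_join [OF _ B(2) _ ac1(2) kinv_biclosed [OF p] Y XY])
      show "U \<subseteq> V2" using V2 by blast
      show "(f, d) \<in> jn V2 V1" if "f < d" "a \<le> f" "d \<le> c" "(f, c) \<in> kinv n p" "(a, d) \<in> kinv n p" for f d
        using cover [OF that] by (simp add: jn_def Un_commute)
    qed
  next
    case False
    have "R (kinv n k) (kinv n (k \<circ> tr e c))"
      by (rule IH [OF k r(2) _ adj2]) (use False e b kb v in \<open>auto simp: kless lev split: if_splits\<close>)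
    then have "R U V2" by (simp add: U_def V2_def)
    then show ?thesis
      by (rule contract_via_join [OF _ B(1) _ ac1(1) kinv_biclosed [OF p] Y XY]) (use V1 cover in auto)
  qed
qed

text \<open>The same argument with the octagon of signed arrangements of \<open>e, c\<close> in the first two
  positions, whose bottom covers are labelled \<open>(e, c)\<close> and \<open>(- e, e)\<close>.\<close>

lemma octagon:
  assumes p: "odd_key n p" and c: "c \<in> vals n" "0 < c" "adjacent n p c (- c)"
    and b: "b \<in> vals n" "- c < b" "b < c" "lo b" "p (- c) < p b"
    and e: "e \<in> vals n" "0 < e" "e < c" "e \<noteq> \<bar>b\<bar>"
    and IH: "\<And>k a' c'. odd_key n k \<Longrightarrow> (a', c') \<in> roots n \<Longrightarrow> c' - a' < c - (- c) \<Longrightarrow> adjacent n k a' c' \<Longrightarrow>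
      a' < b \<Longrightarrow> b < c' \<Longrightarrow> (if lo b then k a' < k b else k b < k c') \<Longrightarrow> R (kinv n k) (kinv n (k \<circ> tr a' c'))"
    and Y: "biclosed n Y" and XY: "kinv n p = Y \<union> {(- c, c), (- c, c)}"
  shows "R (kinv n p) Y"
proof -
  have neg: "p (- x) = - p x" if "x \<in> vals n" for x using odd_key_uminus [OF p that] .
  have pc1: "p c < 0" using c(3) unfolding adjacent_def neg [OF c(1)] by simp
  have pc2: "\<not> (p c < p d \<and> p d < - p c)" if "d \<in> vals n" for d
    using c(3) that unfolding adjacent_def neg [OF c(1)] by blast
  \<comment> \<open>Apart from plus or minus \<open>e\<close> and \<open>c\<close>, exactly one of
    \<open>d\<close> and \<open>- d\<close> has to go to the positive side. Values smaller than
    \<open>c\<close> in size follow \<open>p\<close>; larger ones are placed by their sign.\<close>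
  define A where "A = {d \<in> vals n. (\<bar>d\<bar> < c \<and> - p c < p d \<and> \<bar>d\<bar> \<noteq> e) \<or> c < d}"
  have A_neg: "- d \<notin> A" if "d \<in> A" for d using that neg pc1 c(2) by (auto simp: A_def)
  have A_total: "d \<in> A \<or> - d \<in> A" if "d \<in> vals n" "\<bar>d\<bar> \<noteq> e" "\<bar>d\<bar> \<noteq> c" for d
  proof -
    have "p d \<noteq> p c" "p d \<noteq> - p c"
      using odd_key_eq_iff [OF p that(1), of c] odd_key_eq_iff [OF p that(1), of "- c"] that(3) c neg by auto
    then show ?thesis
      using that pc2 [OF that(1)] neg [OF that(1)] by (auto simp: A_def)
  qed
  have nA: "c \<notin> A" "- c \<notin> A" "e \<notin> A" "- e \<notin> A"
    using c(2) e by (auto simp: A_def)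
  define pl :: "int \<Rightarrow> int"
    where "pl d = (if d = e then 1 else if d = c then 2 else if d \<in> A then 3 else 0)" for d
  define lev where "lev d = pl d - pl (- d)" for d
  define k where "k = lift n lev"
  have k: "odd_key n k" unfolding k_def by (rule lift_odd_key) (simp add: lev_def)
  have kless: "k x < k y \<longleftrightarrow> lev x < lev y \<or> (lev x = lev y \<and> x < y)" if "x \<in> vals n" "y \<in> vals n" for x y
    unfolding k_def using that by (rule lift_less_iff)
  have lev: "lev e = 1" "lev c = 2" "lev (- e) = - 1" "lev (- c) = - 2"
    using e c nA by (auto simp: lev_def pl_def)
  have levA: "lev d = 3" "lev (- d) = - 3" if "d \<in> A" for d
  proof -
    have "d \<notin> {e, c}" "- d \<notin> {e, c}" using that nA by auto
    then show "lev d = 3" "lev (- d) = - 3" using that A_neg [OF that] by (simp_all add: lev_def pl_def)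
  qed
  have lev_cases: "d \<in> {e, - e, c, - c} \<or> (d \<in> A \<and> lev d = 3) \<or> (- d \<in> A \<and> lev d = - 3)" if "d \<in> vals n" for d
  proof (cases "d \<in> {e, - e, c, - c}")
    case False
    then have "\<bar>d\<bar> \<noteq> e" "\<bar>d\<bar> \<noteq> c" by auto
    then show ?thesis using A_total [OF that] levA(1) [of d] levA(2) [of "- d"] by auto
  qed simp
  have mv: "- e \<in> vals n" "- c \<in> vals n" using e c by auto
  have adj1: "adjacent n k e c"
    unfolding adjacent_def
  proof (intro conjI ballI notI)
    show "k e < k c" using c e by (simp add: kless lev)
    fix d assume "d \<in> vals n" "k e < k d \<and> k d < k c"
    then show False using lev_cases [of d] c e mv by (auto simp: kless lev)
  qed
  have adj2: "adjacent n k (- e) e"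
    unfolding adjacent_def
  proof (intro conjI ballI notI)
    show "k (- e) < k e" using mv e by (simp add: kless lev)
    fix d assume "d \<in> vals n" "k (- e) < k d \<and> k d < k e"
    then show False using lev_cases [of d] c e mv by (auto simp: kless lev)
  qed
  define U V1 V2 where "U = kinv n k" and "V1 = kinv n (k \<circ> tr e c)" and "V2 = kinv n (k \<circ> tr (- e) e)"
  have r: "(e, c) \<in> roots n" "(- e, e) \<in> roots n" "(- c, - e) \<in> roots n" using c e by (auto simp: roots_def)
  note V1 = kinv_swap_adjacent(1) [OF k r(1) adj1, folded U_def V1_def]
  note V2 = kinv_swap_adjacent(1) [OF k r(2) adj2, folded U_def V2_def]
  have B: "biclosed n V1" "biclosed n V2"
    unfolding V1_def V2_def using k c e by (auto intro!: kinv_biclosed odd_key_tr)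
  have acU: "(- c, c) \<notin> U" using c by (auto simp: U_def kinv_iff kless lev)
  have ac1: "(- c, c) \<notin> V1" "(- c, c) \<notin> V2"
    using acU e c by (auto simp: V1 V2)
  have cover: "(f, d) \<in> jn V1 V2"
    if fd: "f < d" "- c \<le> f" "d \<le> c" "(f, c) \<in> kinv n p" "(- c, d) \<in> kinv n p" for f d
  proof -
    have fdv: "f \<in> vals n" "d \<in> vals n" "f < c" "- c < d" "p c < p f" "p d < - p c"
      using fd neg [OF c(1)] by (auto simp: kinv_iff)
    have f: "f \<in> {- c, e, - e} \<or> f \<in> A"
      using fd(2) fdv pc2 [of f] odd_key_eq_iff [OF p, of f "- c"] neg c by (force simp: A_def)
    have d: "d \<in> {c, e, - e} \<or> - d \<in> A"
      using fd(3) fdv pc2 [of d] odd_key_eq_iff [OF p, of d c] neg c by (force simp: A_def)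
    have U: "(x, y) \<in> jn V1 V2" if "(x, y) \<in> U" for x y
      using that V1 jn_upper1 [of V1 V2] by blast
    have 1: "(- e, e) \<in> jn V1 V2" "(e, c) \<in> jn V1 V2" "(- c, - e) \<in> jn V1 V2"
      using V1 V2 jn_upper1 [of V1 V2] jn_upper2 [of V2 V1] by blast+
    have 2: "(- e, c) \<in> jn V1 V2" "(- c, e) \<in> jn V1 V2" using jn_trans 1 by blast+
    have 3: "(- c, c) \<in> jn V1 V2" using jn_trans 1 2 by blast
    show ?thesis
    proof (cases "f \<in> A \<or> - d \<in> A")
      case True
      then have "lev d < lev f"
        using f d levA [of f] levA [of "- d"] lev by auto
      then have "(f, d) \<in> U" using fd(1) fdv by (auto simp: U_def kinv_iff kless)
      then show ?thesis by (rule U)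
    next
      case False
      then have "f \<in> {- c, e, - e}" "d \<in> {c, e, - e}" using f d by auto
      then show ?thesis using fd(1) 1 2 3 e c by auto
    qed
  qed
  have bA: "\<bar>b\<bar> \<noteq> e" using e by auto
  then have "b \<in> A" using b neg [OF c(1)] by (auto simp: A_def)
  then have kb: "lev b = 3" by (rule levA)
  show ?thesis
  proof (cases "e < \<bar>b\<bar>")
    case True
    have "R (kinv n k) (kinv n (k \<circ> tr e c))"
    proof (cases "0 < b")
      case pos: True
      show ?thesis
        by (rule IH [OF k r(1) _ adj1]) (use True pos e b kb c in \<open>auto simp: kless lev\<close>)
    next
      \<comment> \<open>For negative \<open>b\<close> the same cover is used under its mirror label
        \<open>(- c, - e)\<close>, which contains \<open>b\<close>.\<close>
      case neg: False
      have adj3: "adjacent n k (- c) (- e)" using adj1 adjacent_uminus [OF k e(1) c(1)] by simp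
      have t: "tr e c = tr (- c) (- e)" using e by (auto simp: tr_def fun_eq_iff)
      show ?thesis unfolding t
        by (rule IH [OF k r(3) _ adj3]) (use True neg e b kb c mv in \<open>auto simp: kless lev\<close>)
    qed
    then have "R U V1" by (simp add: U_def V1_def)
    then show ?thesis
    proof (rule contract_via_join [OF _ B(2) _ ac1(2) kinv_biclosed [OF p] Y])
      show "U \<subseteq> V2" using V2 by blast
      show "kinv n p = Y \<union> {(- c, c), (- c, - (- c))}" using XY by simp
      show "(f, d) \<in> jn V2 V1" if "f < d" "- c \<le> f" "d \<le> c" "(f, c) \<in> kinv n p" "(- c, d) \<in> kinv n p" for f d
        using cover [OF that] by (simp add: jn_def Un_commute)
    qed
  next
    case False
    have "R (kinv n k) (kinv n (k \<circ> tr (- e) e))"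
      by (rule IH [OF k r(2) _ adj2]) (use False bA e b kb mv in \<open>auto simp: kless lev\<close>)
    then have "R U V2" by (simp add: U_def V2_def)
    then show ?thesis
      by (rule contract_via_join [OF _ B(1) _ ac1(1) kinv_biclosed [OF p] Y]) (use XY V1 cover in auto)
  qed
qed

end


section \<open>Labels without a usable third value, and the descent\<close>

lemma prv_uminus: "prv (- b) = - nxt b"
  by (auto simp: prv_def nxt_def)

lemma nxt_uminus: "nxt (- b) = - prv b"
  by (auto simp: prv_def nxt_def)

text \<open>Testing the neighbours of \<open>b\<close> and values of size at most 3 against
  \<open>H\<close> bounds the label: any of them strictly inside it must be one of three negatives.
  The labels listed are those left over when \<open>hexagon\<close> finds no
  \<open>e\<close>.\<close>

lemma triple_cases:
  fixes a b c :: int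
  assumes "a < b" "b < c" "a \<noteq> 0" "b \<noteq> 0" "c \<noteq> 0" "a \<noteq> - c"
    and H: "\<And>e. e \<noteq> 0 \<Longrightarrow> a < e \<Longrightarrow> e < c \<Longrightarrow> e \<noteq> b \<Longrightarrow> e = - a \<or> e = - c \<or> e = - b"
  shows "(a = prv b \<and> c = nxt b) \<or> (a, b, c) \<in> {(- 1, 2, 3), (- 3, - 2, 1)} \<or>
    (\<bar>b\<bar> = 1 \<and> ((a = - 2 \<and> c = 3) \<or> (a = - 3 \<and> c = 2)))"
proof -
  consider "2 \<le> b" | "b = 1" | "b = - 1" | "b \<le> - 2" using assms(4) by linarith
  then show ?thesis
  proof cases
    case 1
    have a: "a = - 1 \<or> 1 \<le> a" using H [of 1] 1 assms(1-3) by force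
    have c: "c = b + 1"
    proof (rule ccontr)
      assume "c \<noteq> b + 1"
      then have "b + 1 < c" using assms(2) by auto
      then show False using H [of "b + 1"] 1 a assms(1) by auto
    qed
    have "a = b - 1 \<or> (a = - 1 \<and> b = 2)"
    proof (rule ccontr)
      assume *: "\<not> ?thesis"
      then have "a < b - 1" using assms(1) by auto
      then show False using H [of "b - 1"] 1 a c * by auto
    qed
    then show ?thesis using 1 c by (auto simp: prv_def nxt_def)
  next
    case 2
    have c: "c = 2 \<or> a = - 2" using H [of 2] 2 assms(1,2) by force
    have c3: "c = 3" if "a = - 2"
    proof (rule ccontr)
      assume "c \<noteq> 3"
      then have "3 < c" using that 2 assms(2,6) by auto
      then show False using H [of 3] 2 that by auto
    qed
    have a: "a = - 1 \<or> a = - 3" if "c = 2"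
    proof (rule ccontr)
      assume "\<not> ?thesis"
      then have "a < - 3" using that 2 assms(1,3,6) by auto
      then show False using H [of "- 3"] 2 that by auto
    qed
    show ?thesis using 2 c c3 a by (auto simp: prv_def nxt_def)
  next
    case 3
    have c: "a = - 2 \<or> c = 2" using H [of "- 2"] 3 assms(1,2) by force
    have a: "a = - 3" if "c = 2"
    proof (rule ccontr)
      assume "a \<noteq> - 3"
      then have "a < - 3" using that 3 assms(1,6) by auto
      then show False using H [of "- 3"] 3 that by auto
    qed
    have c3: "c = 1 \<or> c = 3" if "a = - 2"
    proof (rule ccontr)
      assume "\<not> ?thesis"
      then have "3 < c" using that 3 assms(2,5,6) by auto
      then show False using H [of 3] 3 that by auto
    qed
    show ?thesis using 3 c c3 a by (auto simp: prv_def nxt_def)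
  next
    case 4
    have c: "c = 1 \<or> c \<le> - 1" using H [of "- 1"] 4 assms(1,2,5) by force
    have a: "a = b - 1"
    proof (rule ccontr)
      assume "a \<noteq> b - 1"
      then have "a < b - 1" using assms(1) by auto
      then show False using H [of "b - 1"] 4 c assms(2) by auto
    qed
    have "c = b + 1 \<or> (c = 1 \<and> b = - 2)"
    proof (rule ccontr)
      assume *: "\<not> ?thesis"
      then have "b + 1 < c" using assms(2) by auto
      then show False using H [of "b + 1"] 4 a c * by auto
    qed
    then show ?thesis using 4 a by (auto simp: prv_def nxt_def)
  qed
qed

context set_cong
begin

text \<open>One step of the descent, normalised by \<open>pos\<close>: either both ends of the label
  sit in positive positions, or the label is symmetric and \<open>b\<close> is low.
  \<open>contraction\<close> obtains the other cases by negation.\<close>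

lemma contract_step:
  assumes p: "odd_key n p" and ac: "(a, c) \<in> roots n" "adjacent n p c a"
    and b: "b \<in> vals n" "a < b" "b < c" "if lo b then p a < p b else p b < p c"
    and IH: "\<And>k a' b' c'. odd_key n k \<Longrightarrow> (a', c') \<in> roots n \<Longrightarrow> c' - a' < c - a \<Longrightarrow> adjacent n k a' c' \<Longrightarrow>
      b' \<in> vals n \<Longrightarrow> a' < b' \<Longrightarrow> b' < c' \<Longrightarrow> (if lo b' then k a' < k b' else k b' < k c') \<Longrightarrow>
      R (kinv n k) (kinv n (k \<circ> tr a' c'))"
    and Y: "biclosed n Y" and XY: "kinv n p = Y \<union> {(a, c), (- c, - a)}"
    and pos: "0 < p c \<or> (a = - c \<and> lo b)"
  shows "R (kinv n p) Y"
proof -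
  have v: "a \<in> vals n" "c \<in> vals n" "a < c" using ac by (auto simp: roots_def)
  have neg: "p (- x) = - p x" if "x \<in> vals n" for x using odd_key_uminus [OF p that] .
  have ca: "p c < p a" using ac(2) by (simp add: adjacent_def)
  have X: "biclosed n (kinv n p)" by (rule kinv_biclosed [OF p])
  have between: "e \<in> vals n" if "e \<noteq> 0" "a < e" "e < c" for e
    using that v by (auto simp: vals_def)
  show ?thesis
  proof (cases "0 < p c")
    case True
    have ne: "a \<noteq> - c" using neg [OF v(2)] ca True by auto
    show ?thesis
    proof (cases "\<exists>e \<in> vals n. a < e \<and> e < c \<and> e \<noteq> b \<and> e \<noteq> - a \<and> e \<noteq> - c \<and> \<not> (a < - e \<and> - e < c \<and> p a < p (- e))")
      case good: True
      then obtain e where e: "e \<in> vals n" "a < e" "e < c" "e \<noteq> b" "e \<noteq> - a" "e \<noteq> - c"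
        "\<not> (a < - e \<and> - e < c \<and> p a < p (- e))" by blast
      show ?thesis
        by (rule hexagon [OF p ac True b e _ Y XY]) (rule IH [where b' = b], assumption+, rule b(1))
    next
      case False
      \<comment> \<open>If \<open>e\<close> is blocked because \<open>- e\<close> lies in the label
        and after \<open>a\<close>, then \<open>- e\<close> itself meets all conditions on a third
        value except possibly being different from \<open>b\<close>.\<close>
      have third: "e = - b \<and> lo b" if e: "e \<in> vals n" "a < - e" "- e < c" "p a < p (- e)" for e
      proof -
        have "- e \<noteq> - a" "- e \<noteq> - c" "\<not> p a < p e"
          using e neg v ca True by auto
        then have "- e = b" using False e by (metis minus_minus vals_uminus)
        then show ?thesis using b(4) e(4) ca by (auto split: if_splits)
      qed
      have H: "e = - a \<or> e = - c \<or> (e = - b \<and> lo b)" if "e \<noteq> 0" "a < e" "e < c" "e \<noteq> b" for e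
        using False third [of e] between [OF that(1-3)] that by blast
      have tc: "(a = prv b \<and> c = nxt b) \<or> (a, b, c) \<in> {(- 1, 2, 3), (- 3, - 2, 1)} \<or>
          (\<bar>b\<bar> = 1 \<and> ((a = - 2 \<and> c = 3) \<or> (a = - 3 \<and> c = 2)))"
        by (rule triple_cases) (use H b v ne vals_nz in blast)+
      show ?thesis
      proof (cases "lo b")
        case lo: True
        have ab: "(a, b) \<notin> kinv n p" using lo b(4) by (auto simp: kinv_iff)
        have "(- b, c) \<notin> kinv n p" using lo b neg ca True by (auto simp: kinv_iff)
        then show ?thesis
          using tc by (intro contract_minimal [OF X Y XY lo b(1-3) ab]) (auto simp: abs_if split: if_splits)
      next
        case hi: False
        \<comment> \<open>\<open>contract_minimal\<close> speaks of low values, so the whole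
          configuration is negated.\<close>
        have lo': "lo (- b)" using hi skew b(1) by (simp add: skew_def)
        have "(b, c) \<notin> kinv n p" using hi b(4) by (auto simp: kinv_iff)
        then have ab: "(- c, - b) \<notin> kinv n p" using biclosed_sym [OF X, of c b] by simp
        have XY': "kinv n p = Y \<union> {(- c, - a), (- (- a), - (- c))}" using XY by auto
        have "\<not> (\<bar>b\<bar> = 1 \<and> ((a = - 2 \<and> c = 3) \<or> (a = - 3 \<and> c = 2)))"
        proof
          assume *: "\<bar>b\<bar> = 1 \<and> ((a = - 2 \<and> c = 3) \<or> (a = - 3 \<and> c = 2))"
          then have "b = 1 \<or> b = - 1" by linarith
          then show False using H [of "- b"] hi * by auto
        qed
        then have "- c = prv (- b) \<and> - a = nxt (- b) \<or> (- c, - b, - a) \<in> {(- 1, 2, 3), (- 3, - 2, 1)}"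
          using tc by (simp add: prv_uminus nxt_uminus) (elim disjE conjE; simp)
        then show ?thesis
          using b by (intro contract_minimal [OF X Y XY' lo' _ _ _ ab]) auto
      qed
    qed
  next
    case False
    then have a: "a = - c" and lo: "lo b" using pos by auto
    have c0: "0 < c" using v a by auto
    have XY': "kinv n p = Y \<union> {(- c, c), (- c, c)}" using XY a by auto
    have pb: "p (- c) < p b" using b(4) lo a by simp
    show ?thesis
    proof (cases "\<exists>e \<in> vals n. 0 < e \<and> e < c \<and> e \<noteq> \<bar>b\<bar>")
      case True
      then obtain e where e: "e \<in> vals n" "0 < e" "e < c" "e \<noteq> \<bar>b\<bar>" by blast
      show ?thesis
        by (rule octagon [OF p v(2) c0 ac(2) [unfolded a] b(1) b(2) [unfolded a] b(3) lo pb e _ Y XY'])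
          (rule IH [where b' = b], assumption+, simp add: a, assumption+, rule b(1))
    next
      case False
      have "c = 2 \<and> \<bar>b\<bar> = 1"
      proof -
        have "\<bar>b\<bar> < c" "1 \<le> \<bar>b\<bar>" using b a vals_nz [OF b(1)] by auto
        moreover have "1 = \<bar>b\<bar>" if "1 < c" using False between [of 1] that a by force
        moreover have "2 = \<bar>b\<bar>" if "2 < c" using False between [of 2] that a by force
        ultimately show ?thesis by linarith
      qed
      moreover have "(a, b) \<notin> kinv n p" using pb a by (auto simp: kinv_iff)
      ultimately show ?thesis
        using a by (intro contract_minimal [OF X Y XY lo b(1-3)]) auto
    qed
  qed
qed

lemma contraction:
  assumes "odd_key n k" "(a, c) \<in> roots n" "adjacent n k a c" "b \<in> vals n" "a < b" "b < c"
    "if lo b then k a < k b else k b < k c"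
  shows "R (kinv n k) (kinv n (k \<circ> tr a c))"
  using assms
proof (induction "nat (c - a)" arbitrary: k a b c rule: less_induct)
  case (less a c k b)
  note k = less.prems(1) and ac = less.prems(2) and adj = less.prems(3) and b = less.prems(4-7)
  define p where "p = k \<circ> tr a c"
  have v: "a \<in> vals n" "c \<in> vals n" "a < c" using ac by (auto simp: roots_def)
  have p: "odd_key n p" unfolding p_def by (rule odd_key_tr [OF k v(1,2)])
  have neg: "p (- x) = - p x" if "x \<in> vals n" for x using odd_key_uminus [OF p that] .
  have Y: "biclosed n (kinv n k)" by (rule kinv_biclosed [OF k])
  have XY: "kinv n p = kinv n k \<union> {(a, c), (- c, - a)}"
    unfolding p_def by (rule kinv_swap_adjacent(1) [OF k ac adj])
  have pac: "p a = k c" "p c = k a" by (auto simp: p_def tr_def)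
  have adjp: "adjacent n p c a"
    unfolding adjacent_def pac
  proof (intro conjI ballI)
    show "k a < k c" using adj by (simp add: adjacent_def)
    fix d assume "d \<in> vals n"
    then have "tr a c d \<in> vals n" using Bn_vals [OF tr_Bn [OF v(1,2)]] by simp
    then show "\<not> (k a < p d \<and> p d < k c)" using adj by (simp add: adjacent_def p_def)
  qed
  have pb: "if lo b then p a < p b else p b < p c"
  proof (cases "lo b")
    case True
    then have "(a, b) \<notin> kinv n k" using b by (auto simp: kinv_iff)
    then have "(a, b) \<notin> kinv n p" using XY b by auto
    then show ?thesis
      using True b v odd_key_eq_iff [OF p v(1) b(1)] by (auto simp: kinv_iff)
  next
    case False
    then have "(b, c) \<notin> kinv n k" using b by (auto simp: kinv_iff)
    then have "(b, c) \<notin> kinv n p" using XY b by auto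
    then show ?thesis
      using False b v odd_key_eq_iff [OF p b(1) v(2)] by (auto simp: kinv_iff)
  qed
  have IH: "R (kinv n k') (kinv n (k' \<circ> tr a' c'))"
    if "odd_key n k'" "(a', c') \<in> roots n" "c' - a' < c - a" "adjacent n k' a' c'" "b' \<in> vals n" "a' < b'" "b' < c'"
      "if lo b' then k' a' < k' b' else k' b' < k' c'" for k' a' b' c'
  proof (rule less.hyps [OF _ that(1,2,4-8)])
    show "nat (c' - a') < nat (c - a)" using that(3) v by linarith
  qed
  have mirror: "R (kinv n p) (kinv n k)" if pos: "0 < p (- a) \<or> (- c = - (- a) \<and> lo (- b))"
  proof (rule contract_step [OF p _ _ _ _ _ _ _ Y _ pos])
    show "(- c, - a) \<in> roots n" using ac by (simp add: roots_uminus)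
    show "adjacent n p (- a) (- c)" using adjacent_uminus [OF p v(2,1)] adjp by simp
    show "- b \<in> vals n" "- c < - b" "- b < - a" using b by auto
    have "lo (- b) \<longleftrightarrow> \<not> lo b" using skew b(1) by (simp add: skew_def)
    then show "if lo (- b) then p (- c) < p (- b) else p (- b) < p (- a)"
      using pb neg v b(1) by auto
    show "kinv n p = kinv n k \<union> {(- c, - a), (- (- a), - (- c))}" using XY by auto
  qed (rule IH, (assumption | simp)+)
  consider "0 < p c \<or> (a = - c \<and> lo b)" | "0 < p (- a) \<or> (- c = - (- a) \<and> lo (- b))"
  proof -
    \<comment> \<open>Neighbouring positions have equal signs unless they are opposite. In the
      opposite case the label is symmetric, and one of \<open>b\<close> and \<open>- b\<close> is
      low.\<close>
    have "0 < p c \<or> p a < 0 \<or> a = - c"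
    proof (rule ccontr)
      assume *: "\<not> ?thesis"
      have nz: "p c \<noteq> 0" "p a \<noteq> 0" "p (- a) \<noteq> p c"
        using odd_key_eq_iff [OF p, of c "- c"] odd_key_eq_iff [OF p, of a "- a"] odd_key_eq_iff [OF p, of "- a" c]
          neg v vals_nz * by auto
      then have "p c < 0" "0 < p a" using * by auto
      moreover have "\<not> (p c < p (- a) \<and> p (- a) < p a)" "\<not> (p c < p (- c) \<and> p (- c) < p a)"
        using adjp v by (auto simp: adjacent_def)
      ultimately show False using nz(3) neg v by auto
    qed
    moreover have "lo (- b) \<longleftrightarrow> \<not> lo b" using skew b(1) by (simp add: skew_def)
    ultimately show thesis using that neg v by auto
  qed
  then have "R (kinv n p) (kinv n k)"
  proof cases
    case 1
    show ?thesis by (rule contract_step [OF p ac adjp b(1-3) pb IH Y XY 1])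
  qed (rule mirror)
  then show ?case unfolding p_def by (rule R_sym)
qed

text \<open>Among all violations choose one whose ends are closest in \<open>p\<close>. A value
  placed between them could replace one end, on its own side of \<open>b\<close>, and give a closer
  violation; hence the ends are adjacent and undoing their inversion is a contracted cover.\<close>

lemma not_aligned_contracts:
  assumes X: "biclosed n X" and not: "\<not> aligned n lo X"
  shows "\<exists>Y. R X Y \<and> Y \<subset> X"
proof -
  obtain w where w: "w \<in> Bn n" "invs n w = X" using biclosed_invs [OF X] by blast
  define p where "p = inv w"
  have p: "odd_key n p" "kinv n p = X" using w by (simp_all add: p_def Bn_odd_key Bn_inv)
  define bad where "bad a b c \<longleftrightarrow> (a, c) \<in> X \<and> b \<in> vals n \<and> a < b \<and> b < c \<and>
    (if lo b then p a < p b else p b < p c)" for a b c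
  have "\<exists>a b c. bad a b c"
  proof -
    obtain a b c where abc: "(a, c) \<in> X" "b \<in> vals n" "a < b" "b < c" "\<not> (if lo b then (a, b) \<in> X else (b, c) \<in> X)"
      using not unfolding aligned_def by blast
    have v: "a \<in> vals n" "c \<in> vals n" using biclosed_roots [OF X abc(1)] by auto
    then have "if lo b then p a < p b else p b < p c"
      using abc odd_key_eq_iff [OF p(1) v(1) abc(2)] odd_key_eq_iff [OF p(1) abc(2) v(2)]
      by (auto simp: kinv_iff simp flip: p(2) split: if_splits)
    then show ?thesis using abc(1-4) unfolding bad_def by blast
  qed
  then obtain m where "\<exists>a b c. bad a b c \<and> nat (p a - p c) = m"
      and least: "\<And>j. j < m \<Longrightarrow> \<not> (\<exists>a b c. bad a b c \<and> nat (p a - p c) = j)"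
    using exists_least_iff [of "\<lambda>j. \<exists>a b c. bad a b c \<and> nat (p a - p c) = j"] by blast
  then obtain a b c where abc: "bad a b c" "nat (p a - p c) = m" by blast
  have acX: "(a, c) \<in> X" and b: "b \<in> vals n" "a < b" "b < c" "if lo b then p a < p b else p b < p c"
    using abc(1) by (auto simp: bad_def)
  have v: "a \<in> vals n" "c \<in> vals n" "a < c" "p c < p a" using acX by (auto simp: kinv_iff simp flip: p(2))
  have "\<not> (p c < p d \<and> p d < p a)" if d: "d \<in> vals n" for d
  proof
    assume pd: "p c < p d \<and> p d < p a"
    have "d \<noteq> b" using pd b(4) v(4) by (auto split: if_splits)
    then consider "d < b" | "b < d" by linarith
    then show False
    proof cases
      case 1
      then have "bad d b c"
        using b pd v d by (auto simp: bad_def kinv_iff simp flip: p(2) split: if_splits)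
      moreover have "nat (p d - p c) < m" using abc(2) pd by auto
      ultimately show False using least by blast
    next
      case 2
      then have "bad a b d"
        using b pd v d by (auto simp: bad_def kinv_iff simp flip: p(2) split: if_splits)
      moreover have "nat (p a - p d) < m" using abc(2) pd by auto
      ultimately show False using least by blast
    qed
  qed
  then have adj: "adjacent n p c a" using v by (simp add: adjacent_def)
  define k where "k = p \<circ> tr a c"
  have k: "odd_key n k" unfolding k_def by (rule odd_key_tr [OF p(1) v(1,2)])
  have pk: "p = k \<circ> tr a c" using v by (auto simp: k_def fun_eq_iff tr_tr vals_nz)
  have kac: "k a = p c" "k c = p a" by (auto simp: k_def tr_def)
  have r: "(a, c) \<in> roots n" using v by (simp add: roots_def)
  have adjk: "adjacent n k a c"
    unfolding adjacent_def kac
  proof (intro conjI ballI)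
    fix d assume "d \<in> vals n"
    then have "tr a c d \<in> vals n" using Bn_vals [OF tr_Bn [OF v(1,2)]] by simp
    then show "\<not> (p c < k d \<and> k d < p a)" using adj by (simp add: adjacent_def k_def)
  qed (rule v(4))
  have X_eq: "X = kinv n k \<union> {(a, c), (- c, - a)}" "(a, c) \<notin> kinv n k"
    using kinv_swap_adjacent [OF k r adjk] pk p(2) by auto
  have kb: "if lo b then k a < k b else k b < k c"
  proof (cases "lo b")
    case True
    then have "(a, b) \<notin> X" using b by (auto simp: kinv_iff simp flip: p(2))
    then have "(a, b) \<notin> kinv n k" using X_eq by auto
    then show ?thesis using True b v odd_key_eq_iff [OF k v(1) b(1)] by (auto simp: kinv_iff)
  next
    case False
    then have "(b, c) \<notin> X" using b by (auto simp: kinv_iff simp flip: p(2))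
    then have "(b, c) \<notin> kinv n k" using X_eq by auto
    then show ?thesis using False b v odd_key_eq_iff [OF k b(1) v(2)] by (auto simp: kinv_iff)
  qed
  have "R (kinv n k) (kinv n (k \<circ> tr a c))" by (rule contraction [OF k r adjk b(1-3) kb])
  then have "R X (kinv n k)" using R_sym pk p(2) by simp
  moreover have "kinv n k \<subset> X" using X_eq by auto
  ultimately show ?thesis by blast
qed

end

text \<open>An aligned subset of \<open>gen_upper b\<close> cannot contain
  \<open>(prv b, nxt b)\<close>, because \<open>b\<close> is low and \<open>(prv b, b)\<close> is
  missing. For \<open>b = 1\<close> the pair \<open>(- 2, 2)\<close> would force
  \<open>(- 1, 2)\<close>, just excluded, and for \<open>b = - 1\<close> it would force the missing
  \<open>(- 2, - 1)\<close>.\<close>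

lemma gen_pair_in_down_cong:
  assumes lo: "skew n lo" and x: "x \<in> Bn n" "invs n x = gen_lower b" and y: "y \<in> Bn n" "invs n y = gen_upper b"
    and b: "lo b" "b \<in> vals n" "\<bar>b\<bar> < int n"
  shows "(x, y) \<in> down_cong n lo"
proof -
  have bx: "biclosed n (gen_lower b)" and by': "biclosed n (gen_upper b)"
    using invs_biclosed x y by metis+
  have lo': "lo (- d) \<longleftrightarrow> \<not> lo d" if "d \<in> vals n" for d using lo that by (simp add: skew_def)
  have nb: "nxt b \<in> vals n" "prv b \<in> vals n" "prv b < b" "b < nxt b"
    using b by (auto simp: nxt_def prv_def vals_def)
  have sym: "(- e, - f) \<in> gen_upper b \<longleftrightarrow> (f, e) \<in> gen_upper b" for e f
    using biclosed_sym [OF by'] .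
  have dsym: "(- e, - f) \<in> down n lo (gen_upper b) \<longleftrightarrow> (f, e) \<in> down n lo (gen_upper b)" for e f
    using biclosed_sym [OF down_biclosed [OF lo by']] .
  have down: "(f, e) \<notin> down n lo (gen_upper b)" if "f \<le> prv b" "nxt b \<le> e" "(f, b) \<notin> gen_upper b" for f e
  proof
    assume fe: "(f, e) \<in> down n lo (gen_upper b)"
    then have "f \<in> vals n" using down_subset biclosed_roots [OF by'] by blast
    then have "(f, b) \<in> gen_upper b"
      by (intro downD [OF fe]) (use that nb b in auto)
    then show False using that by simp
  qed
  have 1: "(prv b, nxt b) \<notin> down n lo (gen_upper b)"
    by (rule down) (use nb b in \<open>auto simp: gen_upper_def gen_lower_def nxt_def prv_def vals_def split: if_splits\<close>)
  have 2: "(- 2, 2) \<notin> down n lo (gen_upper b)" if "\<bar>b\<bar> = 1"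
  proof (cases "b = 1")
    case True
    show ?thesis
    proof
      assume fe: "(- 2, 2) \<in> down n lo (gen_upper b)"
      have "(- 1, 2) \<in> down n lo (gen_upper b)"
        using aligned_high [OF down_aligned [OF by'] fe, of "- 1"] lo' [of 1] b True by (auto simp: vals_def)
      then show False using 1 True by (simp add: prv_def nxt_def)
    qed
  next
    case False
    then have "b = - 1" using that by auto
    then show ?thesis
      by (intro down) (auto simp: gen_upper_def gen_lower_def nxt_def prv_def)
  qed
  have "(f, e) \<in> gen_lower b" if fe: "(f, e) \<in> down n lo (gen_upper b)" for f e
  proof -
    have "(f, e) \<noteq> (prv b, nxt b)" "(f, e) \<noteq> (- nxt b, - prv b)" "\<not> (\<bar>b\<bar> = 1 \<and> (f, e) = (- 2, 2))"
      using fe 1 2 dsym [of "nxt b" "prv b"] by auto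
    moreover have "(f, e) \<in> gen_upper b" using fe down_subset by blast
    ultimately show ?thesis by (auto simp: gen_upper_def split: if_splits)
  qed
  then have "down n lo (gen_upper b) \<subseteq> gen_lower b" by auto
  moreover have "aligned n lo (gen_lower b)"
    by (auto simp: aligned_def gen_lower_def nxt_def vals_def split: if_splits)
  moreover have "gen_lower b \<subseteq> gen_upper b" by (auto simp: gen_upper_def)
  ultimately have "down n lo (gen_upper b) = down n lo (gen_lower b)"
    using down_greatest [OF bx] down_aligned_eq [OF bx] by (metis subset_antisym)
  then show ?thesis using x y by (simp add: down_cong_def)
qed

lemma edge_low:
  assumes D: "is_orientation n D" and ab: "(a, b) \<in> D"
  obtains d where "d \<in> vals n" "\<bar>d\<bar> < int n" "low D d" "b < n" "a < n" "invs n (gen b) = gen_lower d"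
    "invs n (word_prod (alt_word b a (mcox a b - 1))) = gen_upper d"
proof -
  have n: "a < n" "b < n" "b = a + 1 \<or> a = b + 1"
    and ex: "\<And>i. i + 1 < n \<Longrightarrow> (i, i + 1) \<in> D \<longleftrightarrow> (i + 1, i) \<notin> D"
    using D ab by (auto simp: is_orientation_def)
  show ?thesis
  proof (cases "b = a + 1")
    case True
    then have a: "a = b - 1" "1 \<le> b" by auto
    then have "low D (int b)" using ab by (simp add: low_def)
    then show ?thesis
      using that [of "int b"] gen_word_invs(1,2) [of b n] n a by (simp add: vals_def)
  next
    case False
    then have b: "b = a - 1" "1 \<le> a" using n by auto
    then have "(a - 1, a) \<notin> D" using ex [of "a - 1"] n ab by simp
    then have "low D (- int a)" using b by (simp add: low_def)
    then show ?thesis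
      using that [of "- int a"] gen_word_invs(3,4) [of a n] n b by (simp add: vals_def)
  qed
qed

text \<open>Each edge is directed in exactly one way, so the low one of \<open>i\<close> and
  \<open>- i\<close> selects the generating pair that is present.\<close>

lemma low_edge:
  assumes D: "is_orientation n D" and d: "d \<in> vals n" "\<bar>d\<bar> < int n" "low D d"
  obtains x y where "(x, y) \<in> cgens D" "invs n x = gen_lower d" "invs n y = gen_upper d"
proof -
  define i where "i = nat \<bar>d\<bar>"
  have i: "1 \<le> i" "i < n" using d by (auto simp: i_def vals_def)
  have ex: "(i - 1, i) \<in> D \<longleftrightarrow> (i, i - 1) \<notin> D"
  proof -
    have "(j, j + 1) \<in> D \<longleftrightarrow> (j + 1, j) \<notin> D" if "j + 1 < n" for j
      using D that unfolding is_orientation_def by blast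
    from this [of "i - 1"] show ?thesis using i by simp
  qed
  show ?thesis
  proof (cases "d > 0")
    case True
    then have "(i - 1, i) \<in> D" "d = int i" using d by (auto simp: low_def i_def)
    then show ?thesis
      using that [of "gen i" "word_prod (alt_word i (i - 1) (mcox (i - 1) i - 1))"] gen_word_invs [OF i]
      by (auto simp: cgens_def)
  next
    case False
    then have "(i, i - 1) \<in> D" "d = - int i" using d ex by (auto simp: low_def i_def vals_def)
    then show ?thesis
      using that [of "gen (i - 1)" "word_prod (alt_word (i - 1) i (mcox i (i - 1) - 1))"] gen_word_invs [OF i]
      by (auto simp: cgens_def)
  qed
qed

section \<open>The Cambrian congruence\<close>

lemma cgens_subset_down_cong:
  assumes D: "is_orientation n D"
  shows "cgens D \<subseteq> down_cong n (low D)"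
proof
  fix z assume "z \<in> cgens D"
  then obtain a b where ab: "(a, b) \<in> D" and z: "z = (gen b, word_prod (alt_word b a (mcox a b - 1)))"
    by (auto simp: cgens_def)
  obtain d where d: "d \<in> vals n" "\<bar>d\<bar> < int n" "low D d" "b < n" "a < n" "invs n (gen b) = gen_lower d"
    "invs n (word_prod (alt_word b a (mcox a b - 1))) = gen_upper d"
    using edge_low [OF D ab] .
  have "is_word n (alt_word b a (mcox a b - 1))" using d by (auto simp: is_word_def alt_word_def)
  then show "z \<in> down_cong n (low D)"
    unfolding z using d by (intro gen_pair_in_down_cong [OF low_skew]) (auto intro: gen_Bn word_prod_Bn)
qed

text \<open>The congruence conditions pass to intersections. \<open>down_cong\<close> belongs to the
  intersected family, which confines \<open>Theta\<close> to pairs from \<open>Bn n\<close>.\<close>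

lemma Theta_lattice_cong:
  assumes D: "is_orientation n D"
  shows "lattice_cong n (Theta n D)" "Theta n D \<subseteq> down_cong n (low D)" "cgens D \<subseteq> Theta n D"
proof -
  show sub: "Theta n D \<subseteq> down_cong n (low D)"
    unfolding Theta_def
    using down_cong_lattice_cong [OF low_skew] cgens_subset_down_cong [OF D] by blast
  show "cgens D \<subseteq> Theta n D" unfolding Theta_def by blast
  have T: "(x, y) \<in> Theta n D \<longleftrightarrow> (\<forall>C. lattice_cong n C \<longrightarrow> cgens D \<subseteq> C \<longrightarrow> (x, y) \<in> C)" for x y
    unfolding Theta_def by blast
  have eq: "equiv (Bn n) C" if "lattice_cong n C" for C using that by (simp add: lattice_cong_def)
  have "equiv (Bn n) (Theta n D)"
  proof (rule equivI)
    show "Theta n D \<subseteq> Bn n \<times> Bn n" using sub by (auto simp: down_cong_def)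
    show "refl_on (Bn n) (Theta n D)"
      using eq by (auto simp: refl_on_def T equiv_def)
    show "sym (Theta n D)" unfolding sym_def T using eq by (meson equiv_def symD)
    show "trans (Theta n D)" unfolding trans_def T using eq by (meson equiv_def transD)
  qed
  moreover have "(m1, m2) \<in> Theta n D"
    if "(x, y) \<in> Theta n D" "z \<in> Bn n" "is_meet n x z m1" "is_meet n y z m2" for x y z m1 m2
    unfolding T
  proof (intro allI impI)
    fix C assume C: "lattice_cong n C" "cgens D \<subseteq> C"
    then have "(x, y) \<in> C" using that(1) T by blast
    then show "(m1, m2) \<in> C" using C(1) that(2-4) unfolding lattice_cong_def by blast
  qed
  moreover have "(j1, j2) \<in> Theta n D"
    if "(x, y) \<in> Theta n D" "z \<in> Bn n" "is_join n x z j1" "is_join n y z j2" for x y z j1 j2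
    unfolding T
  proof (intro allI impI)
    fix C assume C: "lattice_cong n C" "cgens D \<subseteq> C"
    then have "(x, y) \<in> C" using that(1) T by blast
    then show "(j1, j2) \<in> C" using C(1) that(2-4) unfolding lattice_cong_def by blast
  qed
  ultimately show "lattice_cong n (Theta n D)"
    unfolding lattice_cong_def by blast
qed

lemma cambrian_mins_iff:
  assumes D: "is_orientation n D"
  shows "x \<in> cambrian_mins n D \<longleftrightarrow> x \<in> Bn n \<and> aligned n (low D) (invs n x)"
proof -
  define R where "R X Y \<longleftrightarrow> (\<exists>x y. (x, y) \<in> Theta n D \<and> X = invs n x \<and> Y = invs n y)" for X Y
  note T = Theta_lattice_cong [OF D]
  have TB: "x \<in> Bn n \<and> y \<in> Bn n" if "(x, y) \<in> Theta n D" for x y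
    using that T(2) by (auto simp: down_cong_def)
  interpret set_cong n "low D" R
  proof
    show "skew n (low D)" by (rule low_skew)
    show "biclosed n X \<and> biclosed n Y" if "R X Y" for X Y
      using that TB invs_biclosed by (auto simp: R_def)
    show "R Y X" if "R X Y" for X Y
    proof -
      have "sym (Theta n D)" using T(1) by (simp add: lattice_cong_def equiv_def)
      then show ?thesis using that unfolding R_def by (metis symD)
    qed
    show "R (jn X Z) (jn Y Z)" if XY: "R X Y" and Z: "biclosed n Z" for X Y Z
    proof -
      obtain x y where xy: "(x, y) \<in> Theta n D" "X = invs n x" "Y = invs n y" using XY by (auto simp: R_def)
      obtain z where z: "z \<in> Bn n" "invs n z = Z" using biclosed_invs [OF Z] by blast
      have B: "biclosed n X" "biclosed n Y" using xy TB invs_biclosed by auto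
      obtain j where j: "j \<in> Bn n" "invs n j = jn X Z" using biclosed_invs [OF jn_biclosed [OF B(1) Z]] by blast
      obtain k where k: "k \<in> Bn n" "invs n k = jn Y Z" using biclosed_invs [OF jn_biclosed [OF B(2) Z]] by blast
      have "is_join n x z j" "is_join n y z k" using j k xy z TB by (auto simp: is_join_iff)
      then have "(j, k) \<in> Theta n D" using T(1) xy(1) z(1) unfolding lattice_cong_def by blast
      then show ?thesis using j k by (auto simp: R_def)
    qed
    show "R (mt n X Z) (mt n Y Z)" if XY: "R X Y" and Z: "biclosed n Z" for X Y Z
    proof -
      obtain x y where xy: "(x, y) \<in> Theta n D" "X = invs n x" "Y = invs n y" using XY by (auto simp: R_def)
      obtain z where z: "z \<in> Bn n" "invs n z = Z" using biclosed_invs [OF Z] by blast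
      have B: "biclosed n X" "biclosed n Y" using xy TB invs_biclosed by auto
      obtain j where j: "j \<in> Bn n" "invs n j = mt n X Z" using biclosed_invs [OF mt_biclosed [OF B(1) Z]] by blast
      obtain k where k: "k \<in> Bn n" "invs n k = mt n Y Z" using biclosed_invs [OF mt_biclosed [OF B(2) Z]] by blast
      have "is_meet n x z j" "is_meet n y z k" using j k xy z TB by (auto simp: is_meet_iff)
      then have "(j, k) \<in> Theta n D" using T(1) xy(1) z(1) unfolding lattice_cong_def by blast
      then show ?thesis using j k by (auto simp: R_def)
    qed
    show "R (gen_lower b) (gen_upper b)" if b: "b \<in> vals n" "\<bar>b\<bar> < int n" "low D b" for b
    proof -
      obtain x y where xy: "(x, y) \<in> cgens D" "invs n x = gen_lower b" "invs n y = gen_upper b"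
        using low_edge [OF D b] .
      then have "(x, y) \<in> Theta n D" using T(3) by blast
      then show ?thesis unfolding R_def using xy(2,3) by blast
    qed
  qed
  show ?thesis
  proof
    assume x: "x \<in> cambrian_mins n D"
    then have xB: "x \<in> Bn n" by (simp add: cambrian_mins_def)
    have "aligned n (low D) (invs n x)"
    proof (rule ccontr)
      assume "\<not> aligned n (low D) (invs n x)"
      then obtain Y where Y: "R (invs n x) Y" "Y \<subset> invs n x"
        using not_aligned_contracts [OF invs_biclosed [OF xB]] by blast
      obtain x' y where xy: "(x', y) \<in> Theta n D" "invs n x = invs n x'" "Y = invs n y"
        using Y(1) by (auto simp: R_def)
      have "x' = x" using invs_inject TB [OF xy(1)] xB xy(2) by metis
      moreover have "wle n y x" "y \<noteq> x" using Y(2) xy(3) TB [OF xy(1)] xB by (auto simp: wle_iff)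
      ultimately show False using x xy(1) TB [OF xy(1)] by (auto simp: cambrian_mins_def)
    qed
    then show "x \<in> Bn n \<and> aligned n (low D) (invs n x)" using xB by simp
  next
    assume x: "x \<in> Bn n \<and> aligned n (low D) (invs n x)"
    have "y = x" if y: "y \<in> Bn n" "(x, y) \<in> Theta n D" "wle n y x" for y
    proof -
      \<comment> \<open>An aligned \<open>x\<close> is its own aligned part, and this part is shared
        by every \<open>y\<close> in its class, so \<open>x\<close> lies below
        \<open>y\<close>.\<close>
      have "invs n x = down n (low D) (invs n x)"
        using x down_aligned_eq [OF invs_biclosed] by metis
      also have "\<dots> = down n (low D) (invs n y)" using y(2) T(2) by (auto simp: down_cong_def)
      also have "\<dots> \<subseteq> invs n y" by (rule down_subset)
      finally have "invs n x = invs n y" using y(1,3) x by (auto simp: wle_iff)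
      then show ?thesis using invs_inject x y(1) by metis
    qed
    then show "x \<in> cambrian_mins n D" using x by (auto simp: cambrian_mins_def)
  qed
qed

theorem theorem7p6:
  fixes n :: nat and D :: "(nat \<times> nat) set"
  assumes "1 \<le> n" and "is_orientation n D"
  shows "(\<forall>x y m. x \<in> cambrian_mins n D \<longrightarrow> y \<in> cambrian_mins n D \<longrightarrow> is_meet n x y m
            \<longrightarrow> m \<in> cambrian_mins n D) \<and>
         (\<forall>x y j. x \<in> cambrian_mins n D \<longrightarrow> y \<in> cambrian_mins n D \<longrightarrow> is_join n x y j
            \<longrightarrow> j \<in> cambrian_mins n D)"
proof (intro conjI allI impI)
  fix x y m
  assume xy: "x \<in> cambrian_mins n D" "y \<in> cambrian_mins n D" and m: "is_meet n x y m"
  then have x: "x \<in> Bn n" "aligned n (low D) (invs n x)" and y: "y \<in> Bn n" "aligned n (low D) (invs n y)"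
    by (auto simp: cambrian_mins_iff [OF assms(2)])
  note Int = aligned_Int_biclosed [OF invs_biclosed [OF x(1)] x(2) invs_biclosed [OF y(1)] y(2)]
  have m': "m \<in> Bn n" "invs n m = mt n (invs n x) (invs n y)" using m x y by (auto simp: is_meet_iff)
  have "mt n (invs n x) (invs n y) = invs n x \<inter> invs n y"
    using mt_lower [OF invs_biclosed [OF x(1)] invs_biclosed [OF y(1)]] mt_greatest [OF Int(1)]
    by blast
  then show "m \<in> cambrian_mins n D" using m' Int(2) by (simp add: cambrian_mins_iff [OF assms(2)])
next
  fix x y j
  assume xy: "x \<in> cambrian_mins n D" "y \<in> cambrian_mins n D" and j: "is_join n x y j"
  then have x: "x \<in> Bn n" "aligned n (low D) (invs n x)" and y: "y \<in> Bn n" "aligned n (low D) (invs n y)"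
    by (auto simp: cambrian_mins_iff [OF assms(2)])
  then have "j \<in> Bn n" "invs n j = jn (invs n x) (invs n y)" using j by (auto simp: is_join_iff)
  then show "j \<in> cambrian_mins n D"
    using aligned_jn [OF invs_biclosed [OF x(1)] x(2) invs_biclosed [OF y(1)] y(2)]
    by (simp add: cambrian_mins_iff [OF assms(2)])
qed

end
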